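(* The parameterized problem Stable Cutset[mod co-cluster] admits a polynomial kernelization to equivalent instances with $\mathcal{O}(|X|^3)$ vertices. That is, there is an algorithm running in time polynomial in the input size which, given a graph $G$ and a set $X\subseteq V(G)$ such that $G-X$ is a co-cluster graph, outputs a graph $G'$ and a set $X'\subseteq V(G')$ such that $G'-X'$ is a co-cluster graph, $G'$ has a stable cutset if and only if $G$ has a stable cutset, and $|V(G')|\le c\cdot |X|^3$ for some absolute constant $c$.
   Context: All graphs are finite and simple. A stable cutset of a graph $G$ is a set $S\subseteq V(G)$ whose vertices are pairwise non-adjacent and such that $G-S$ is disconnected (has at least two connected components); the empty set is a stable cutset of any disconnected graph. A co-cluster graph is a graph whose complement is a disjoint union of cliques, equivalently a join of stable sets (a complete multipartite graph). Stable Cutset[mod co-cluster]: input is a graph $G$ and $X\subseteq V(G)$ with $G-X$ a co-cluster graph; the parameter is $|X|$; the question is whether $G$ has a stable cutset. A kernelization may alternatively output a constant-size yes- or no-instance. *)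

theory Defs
  imports
    "Graph_Theory.Graph_Theory"
    "HOL-Library.Disjoint_Sets"
    "HOL-Computational_Algebra.Polynomial"
begin

section \<open>Stable cutsets and co-cluster graphs\<close>

text \<open>Finite simple graphs are the \<open>pair_graph\<close>s of the library: finite, loop-free, symmetric arc
  relation. An undirected edge is the pair of its two orientations, so the strongly connected
  components of such a graph are its connected components.\<close>

definition del_verts :: "'a pair_pre_digraph \<Rightarrow> 'a set \<Rightarrow> ('a, 'a \<times> 'a) pre_digraph" where
  "del_verts G S = with_proj G \<restriction> (pverts G - S)"

definition stable_set :: "'a pair_pre_digraph \<Rightarrow> 'a set \<Rightarrow> bool" where
  "stable_set G S \<longleftrightarrow> S \<subseteq> pverts G \<and> (\<forall>u\<in>S. \<forall>v\<in>S. (u, v) \<notin> parcs G)"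

text \<open>Counting components matters here: the library's \<open>connected\<close> is false on the graph
  without vertices, which is not disconnected.\<close>

definition disconnected :: "('a, 'b) pre_digraph \<Rightarrow> bool" where
  "disconnected H \<longleftrightarrow> 2 \<le> card (pre_digraph.sccs H)"

definition stable_cutset :: "'a pair_pre_digraph \<Rightarrow> 'a set \<Rightarrow> bool" where
  "stable_cutset G S \<longleftrightarrow> stable_set G S \<and> disconnected (del_verts G S)"

definition has_stable_cutset :: "'a pair_pre_digraph \<Rightarrow> bool" where
  "has_stable_cutset G \<longleftrightarrow> (\<exists>S. stable_cutset G S)"

definition complement :: "('a, 'b) pre_digraph \<Rightarrow> 'a pair_pre_digraph" where
  "complement H = \<lparr> pverts = verts H,
     parcs = {(u, v). u \<in> verts H \<and> v \<in> verts H \<and> u \<noteq> v \<and> (u, v) \<notin> arcs_ends H} \<rparr>"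

text \<open>Disjoint union of cliques; \<open>P\<close> is the set of the vertex sets of the cliques.\<close>

definition cluster_graph :: "'a pair_pre_digraph \<Rightarrow> bool" where
  "cluster_graph H \<longleftrightarrow> (\<exists>P. partition_on (pverts H) P \<and>
     parcs H = {(u, v). u \<noteq> v \<and> (\<exists>B\<in>P. u \<in> B \<and> v \<in> B)})"

definition co_cluster_graph :: "('a, 'b) pre_digraph \<Rightarrow> bool" where
  "co_cluster_graph H \<longleftrightarrow> cluster_graph (complement H)"

definition mod_co_cluster_instance :: "'a pair_pre_digraph \<Rightarrow> 'a set \<Rightarrow> bool" where
  "mod_co_cluster_instance G X \<longleftrightarrow>
     pair_graph G \<and> X \<subseteq> pverts G \<and> co_cluster_graph (del_verts G X)"

section \<open>Random access machines\<close>

text \<open>While-programs over a random access machine with registers, an unbounded memory with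
  indirect addressing, and a write-only output. The only arithmetic is addition and truncated
  subtraction, so a step lengthens the largest number by at most one bit and unit-cost
  running time is polynomially related to Turing machine time.\<close>

record ram_state =
  reg :: "nat \<Rightarrow> nat"
  mem :: "nat \<Rightarrow> nat"
  out :: "nat list"

datatype com =
    Skip
  | Const nat nat      \<comment> \<open>\<open>r\<^sub>i := k\<close>\<close>
  | Add nat nat nat    \<comment> \<open>\<open>r\<^sub>i := r\<^sub>j + r\<^sub>k\<close>\<close>
  | Sub nat nat nat    \<comment> \<open>\<open>r\<^sub>i := r\<^sub>j - r\<^sub>k\<close>\<close>
  | Load nat nat       \<comment> \<open>\<open>r\<^sub>i := mem[r\<^sub>j]\<close>\<close>
  | Store nat nat      \<comment> \<open>\<open>mem[r\<^sub>i] := r\<^sub>j\<close>\<close>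
  | Write nat          \<comment> \<open>append \<open>r\<^sub>i\<close> to the output\<close>
  | Seq com com
  | If nat com com     \<comment> \<open>branch on \<open>r\<^sub>i \<noteq> 0\<close>\<close>
  | While nat com      \<comment> \<open>loop as long as \<open>r\<^sub>i \<noteq> 0\<close>\<close>

text \<open>\<open>exec c s t s'\<close>: started in \<open>s\<close>, the program \<open>c\<close> halts in \<open>s'\<close> after \<open>t\<close> steps.\<close>

inductive exec :: "com \<Rightarrow> ram_state \<Rightarrow> nat \<Rightarrow> ram_state \<Rightarrow> bool" where
  Skip: "exec Skip s 1 s"
| Const: "exec (Const i k) s 1 (s\<lparr>reg := (reg s)(i := k)\<rparr>)"
| Add: "exec (Add i j k) s 1 (s\<lparr>reg := (reg s)(i := reg s j + reg s k)\<rparr>)"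
| Sub: "exec (Sub i j k) s 1 (s\<lparr>reg := (reg s)(i := reg s j - reg s k)\<rparr>)"
| Load: "exec (Load i j) s 1 (s\<lparr>reg := (reg s)(i := mem s (reg s j))\<rparr>)"
| Store: "exec (Store i j) s 1 (s\<lparr>mem := (mem s)(reg s i := reg s j)\<rparr>)"
| Write: "exec (Write i) s 1 (s\<lparr>out := out s @ [reg s i]\<rparr>)"
| Seq: "exec c s t s' \<Longrightarrow> exec d s' u s'' \<Longrightarrow> exec (Seq c d) s (t + u) s''"
| IfTrue: "reg s i \<noteq> 0 \<Longrightarrow> exec c s t s' \<Longrightarrow> exec (If i c d) s (t + 1) s'"
| IfFalse: "reg s i = 0 \<Longrightarrow> exec d s t s' \<Longrightarrow> exec (If i c d) s (t + 1) s'"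
| WhileFalse: "reg s i = 0 \<Longrightarrow> exec (While i c) s 1 s"
| WhileTrue: "reg s i \<noteq> 0 \<Longrightarrow> exec c s t s' \<Longrightarrow> exec (While i c) s' u s'' \<Longrightarrow>
    exec (While i c) s (t + u + 1) s''"

inductive_cases exec_elims:
  "exec Skip s t s'" "exec (Const i k) s t s'" "exec (Add i j k) s t s'" "exec (Sub i j k) s t s'"
  "exec (Load i j) s t s'" "exec (Store i j) s t s'" "exec (Write i) s t s'"
inductive_cases exec_SeqE: "exec (Seq c d) s t s'"
inductive_cases exec_IfE: "exec (If i c d) s t s'"
inductive_cases exec_WhileE: "exec (While i c) s t s'"

lemma exec_deterministic: "exec c s t s' \<Longrightarrow> exec c s u s'' \<Longrightarrow> t = u \<and> s' = s''"
proof (induction arbitrary: u s'' rule: exec.induct)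
  case (Seq c s t s' d v s1)
  from Seq.prems show ?case by (rule exec_SeqE) (use Seq.IH in metis)
next
  case (IfTrue s i c t s' d)
  from IfTrue.prems show ?case by (rule exec_IfE) (simp_all add: IfTrue.hyps IfTrue.IH)
next
  case (IfFalse s i d t s' c)
  from IfFalse.prems show ?case by (rule exec_IfE) (simp_all add: IfFalse.hyps IfFalse.IH)
next
  case (WhileFalse s i c)
  from WhileFalse.prems show ?case by (rule exec_WhileE) (simp_all add: WhileFalse.hyps)
next
  case (WhileTrue s i c t s' v s1)
  have *: "t = t' \<and> v = v'  \<and> s1 = s''"
    if "exec c s t' r" "exec (While i c) r v' s''" for t' r v'
  proof -
    from WhileTrue.IH(1)[OF that(1)] have "t = t'" "s' = r" by auto
    with WhileTrue.IH(2) that(2) show ?thesis by auto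
  qed
  from WhileTrue.prems show ?case
    by (rule exec_WhileE) (use WhileTrue.hyps in simp, use * in simp)
qed (erule exec_elims, simp)+

definition input_state :: "nat list \<Rightarrow> ram_state" where
  "input_state xs = \<lparr> reg = (\<lambda>i. 0),
     mem = (\<lambda>i. if i < length xs then xs ! i else 0), out = [] \<rparr>"

definition ram_computes_within :: "com \<Rightarrow> nat list \<Rightarrow> nat \<Rightarrow> nat list \<Rightarrow> bool" where
  "ram_computes_within c xs T ys \<longleftrightarrow>
     (\<exists>t s. exec c (input_state xs) t s \<and> t \<le> T \<and> out s = ys)"

text \<open>The encoding of \<open>(G, X)\<close> for an arbitrary enumeration \<open>vs\<close> of the vertices: their number,
  the characteristic vector of \<open>X\<close>, and the rows of the adjacency matrix. The names of
  the vertices are invisible to the program.\<close>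

definition enumerates :: "'a list \<Rightarrow> 'a pair_pre_digraph \<Rightarrow> bool" where
  "enumerates vs G \<longleftrightarrow> distinct vs \<and> set vs = pverts G"

definition encode :: "'a list \<Rightarrow> 'a pair_pre_digraph \<Rightarrow> 'a set \<Rightarrow> nat list" where
  "encode vs G X = length vs # map (\<lambda>v. of_bool (v \<in> X)) vs
     @ concat (map (\<lambda>u. map (\<lambda>v. of_bool ((u, v) \<in> parcs G)) vs) vs)"

end

theory Submission
  imports Defs
begin

text \<open>A stable cutset amounts to disjoint nonempty sets \<open>A\<close>, \<open>B\<close> without edges between them
  whose complement \<open>S\<close> is stable. In the co-cluster part \<open>H = G - X\<close>, non-adjacency means lying in the
  same part, so whether a vertex of \<open>H\<close> can be placed depends only on its part and on which colours
  among \<open>A\<close>, \<open>B\<close>, \<open>S\<close> occur among its neighbours in \<open>X\<close>, and at most three neighbours witness an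
  obstruction. Hence it suffices to keep, for each triple in \<open>X\<close> (and for the empty one), common
  neighbours in up to three distinct parts. The restriction of \<open>(A, B)\<close> to the kept vertices can only
  fail to have two nonempty sides if some vertex has a stable neighbourhood; such a vertex is kept too,
  and together with three vertices in total it already yields a stable cutset.

  The kept set is definable by a fixed first-order formula over adjacency, \<open>X\<close> and the order of
  the enumeration, and first-order formulas can be evaluated by brute force in polynomial time. The
  instance put out is the induced subgraph on the kept set, with \<open>X'\<close> being its whole vertex set.\<close>

section \<open>Separations and stable cutsets\<close>

text \<open>Sharing a strongly connected component means mutual reachability, so there are two
  components exactly if some ordered pair is unreachable. This trades counting for
  reachability.\<close>

lemma (in pseudo_graph) disconnected_iff_unreachable:
  "disconnected G \<longleftrightarrow> (\<exists>u\<in>verts G. \<exists>v\<in>verts G. \<not> u \<rightarrow>\<^sup>*\<^bsub>G\<^esub> v)"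
proof
  assume "disconnected G"
  then have "2 \<le> card sccs_verts"
    by (simp add: disconnected_def card_sccs_verts)
  then obtain S T where ST: "S \<in> sccs_verts" "T \<in> sccs_verts" "S \<noteq> T"
    by (metis card_le_Suc0_iff_eq finite_sccs_verts not_less_eq_eq numeral_2_eq_2)
  then obtain u v where "u \<in> verts G" "v \<in> verts G" "S = scc_of u" "T = scc_of v"
    by (auto simp: sccs_verts_conv_scc_of)
  with ST(3) show "\<exists>u\<in>verts G. \<exists>v\<in>verts G. \<not> u \<rightarrow>\<^sup>*\<^bsub>G\<^esub> v"
    by (metis scc_ofI_reachable scc_of_eq)
next
  assume "\<exists>u\<in>verts G. \<exists>v\<in>verts G. \<not> u \<rightarrow>\<^sup>*\<^bsub>G\<^esub> v"
  then obtain u v where uv: "u \<in> verts G" "v \<in> verts G" "\<not> u \<rightarrow>\<^sup>*\<^bsub>G\<^esub> v"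
    by blast
  then have "scc_of u \<noteq> scc_of v"
    using in_scc_of_self[of v] by (auto simp: scc_of_def)
  then have "card {scc_of u, scc_of v} = 2"
    by simp
  moreover have "{scc_of u, scc_of v} \<subseteq> sccs_verts"
    using uv by (auto simp: sccs_verts_conv_scc_of)
  ultimately show "disconnected G"
    unfolding disconnected_def using card_mono[OF finite_sccs_verts] card_sccs_verts by metis
qed

text \<open>The cutset is left implicit as \<open>V - (A \<union> B)\<close>. Each side is a union
  of components rather than a single one, so vertices can join a side without any concern for
  connectivity.\<close>

definition separation :: "'a set \<Rightarrow> ('a \<times> 'a) set \<Rightarrow> 'a set \<Rightarrow> 'a set \<Rightarrow> bool" where
  "separation V E A B \<longleftrightarrow> A \<subseteq> V \<and> B \<subseteq> V \<and> A \<inter> B = {} \<and> A \<noteq> {} \<and> B \<noteq> {} \<and>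
     (\<forall>a\<in>A. \<forall>b\<in>B. (a, b) \<notin> E) \<and> (\<forall>u\<in>V - (A \<union> B). \<forall>v\<in>V - (A \<union> B). (u, v) \<notin> E)"

lemma arcs_ends_del_verts:
  "arcs_ends (del_verts G S) = {(u, v) \<in> parcs G. u \<in> pverts G - S \<and> v \<in> pverts G - S}"
  unfolding del_verts_def by (auto simp: arcs_ends_def arc_to_ends_def)

text \<open>From a cutset, \<open>A\<close> is what one remaining vertex reaches and
  \<open>B\<close> is the rest; conversely, walks from \<open>A\<close> that avoid the cutset never
  leave \<open>A\<close>. Cutsets then become vertex colourings and walks disappear.\<close>

lemma has_stable_cutset_iff_separation:
  assumes "pair_graph G"
  shows "has_stable_cutset G \<longleftrightarrow> (\<exists>A B. separation (pverts G) (parcs G) A B)"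
proof -
  interpret G: pair_graph G by fact
  have pg: "pseudo_graph (del_verts G S)" for S
  proof -
    have "induced_subgraph (del_verts G S) (with_proj G)"
      unfolding del_verts_def by (rule G.induced_induce) auto
    then interpret D: digraph "del_verts G S"
      using G.digraphI_induced by blast
    have "symmetric (del_verts G S)"
      using G.pair_sym_arcs
      by (auto simp: symmetric_def arcs_ends_del_verts intro!: symI dest: symD)
    then show ?thesis
      by unfold_locales
  qed
  show ?thesis
  proof
    assume "has_stable_cutset G"
    then obtain S where S: "stable_set G S" "disconnected (del_verts G S)"
      by (auto simp: has_stable_cutset_def stable_cutset_def)
    interpret D: pseudo_graph "del_verts G S" by (rule pg)
    have vD: "verts (del_verts G S) = pverts G - S"
      by (simp add: del_verts_def)
    from S(2) obtain u v where uv: "u \<in> pverts G - S" "v \<in> pverts G - S"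
      "\<not> u \<rightarrow>\<^sup>*\<^bsub>del_verts G S\<^esub> v"
      unfolding D.disconnected_iff_unreachable vD by blast
    define A where "A = {w. u \<rightarrow>\<^sup>*\<^bsub>del_verts G S\<^esub> w}"
    have A: "A \<subseteq> pverts G - S"
      unfolding A_def vD[symmetric] using D.reachable_in_verts by blast
    have "u \<in> A"
      unfolding A_def using uv(1) vD by auto
    have "(a, b) \<notin> parcs G" if "a \<in> A" "b \<in> pverts G - S - A" for a b
    proof
      assume "(a, b) \<in> parcs G"
      with that A have "a \<rightarrow>\<^bsub>del_verts G S\<^esub> b"
        by (auto simp: arcs_ends_del_verts)
      with that(1) have "b \<in> A"
        unfolding A_def using D.reachable_adj_trans by blast
      with that(2) show False by blast
    qed
    moreover have "v \<notin> A" using uv(3) by (simp add: A_def)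
    moreover have "pverts G - (A \<union> (pverts G - S - A)) = S"
      using S(1) A by (auto simp: stable_set_def)
    ultimately have "separation (pverts G) (parcs G) A (pverts G - S - A)"
      using A \<open>u \<in> A\<close> uv(2) S(1) unfolding separation_def stable_set_def by auto
    then show "\<exists>A B. separation (pverts G) (parcs G) A B" by blast
  next
    assume "\<exists>A B. separation (pverts G) (parcs G) A B"
    then obtain A B where AB: "separation (pverts G) (parcs G) A B" by blast
    define S where "S = pverts G - (A \<union> B)"
    interpret D: pseudo_graph "del_verts G S" by (rule pg)
    have vD: "verts (del_verts G S) = A \<union> B"
      using AB by (auto simp: del_verts_def S_def separation_def)
    obtain a b where ab: "a \<in> A" "b \<in> B"
      using AB by (auto simp: separation_def)
    have "w \<in> A" if "a \<rightarrow>\<^sup>*\<^bsub>del_verts G S\<^esub> w" for w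
      using that
    proof (induction rule: D.reachable_induct)
      case base
      show ?case by fact
    next
      case (step x y)
      then have "(x, y) \<in> parcs G" "y \<in> A \<union> B"
        using D.adj_in_verts(2)[of x y] vD by (auto simp: arcs_ends_del_verts)
      with step.IH AB show ?case by (auto simp: separation_def)
    qed
    with ab AB have "\<not> a \<rightarrow>\<^sup>*\<^bsub>del_verts G S\<^esub> b"
      by (auto simp: separation_def)
    with ab vD have "disconnected (del_verts G S)"
      unfolding D.disconnected_iff_unreachable by blast
    moreover have "stable_set G S"
      using AB by (auto simp: stable_set_def separation_def S_def)
    ultimately show "has_stable_cutset G"
      by (auto simp: has_stable_cutset_def stable_cutset_def)
  qed
qed

section \<open>Non-adjacency in co-cluster graphs and representatives of its classes\<close>

text \<open>Distinct non-adjacent vertices share a clique of the complement, and these cliques are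
  disjoint. \<open>complement\<close> does not see loops, hence the premise
  \<open>u \<noteq> w\<close>.\<close>

lemma co_cluster_nonadjacent_trans:
  assumes "co_cluster_graph (del_verts G X)"
    and "u \<in> pverts G - X" "v \<in> pverts G - X" "w \<in> pverts G - X"
    and "(u, v) \<notin> parcs G" "(v, w) \<notin> parcs G" "u \<noteq> w"
  shows "(u, w) \<notin> parcs G"
proof -
  obtain P where P: "partition_on (pverts G - X) P"
    "{(u, v). u \<in> pverts G - X \<and> v \<in> pverts G - X \<and> u \<noteq> v \<and> (u, v) \<notin> parcs G}
      = {(u, v). u \<noteq> v \<and> (\<exists>B\<in>P. u \<in> B \<and> v \<in> B)}"
  proof -
    have "complement (del_verts G X) = \<lparr>pverts = pverts G - X,
      parcs = {(u, v). u \<in> pverts G - X \<and> v \<in> pverts G - X \<and> u \<noteq> v \<and> (u, v) \<notin> parcs G}\<rparr>"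
      unfolding complement_def arcs_ends_del_verts by (auto simp: del_verts_def)
    with assms(1) that show thesis
      unfolding co_cluster_graph_def cluster_graph_def by auto
  qed
  have *: "(\<exists>B\<in>P. u \<in> B \<and> v \<in> B) \<longleftrightarrow> (u, v) \<notin> parcs G"
    if "u \<in> pverts G - X" "v \<in> pverts G - X" "u \<noteq> v" for u v
    using P(2) that by (auto simp: set_eq_iff)
  show ?thesis
  proof (cases "u = v \<or> v = w")
    case True
    with assms show ?thesis by auto
  next
    case False
    then obtain B C where "B \<in> P" "u \<in> B" "v \<in> B" "C \<in> P" "v \<in> C" "w \<in> C"
      using * assms by metis
    moreover from this have "B = C"
      using P(1) partition_onD2[of _ P] by (auto simp: disjoint_def)
    ultimately show ?thesis using * assms by blast
  qed
qed

text \<open>When non-adjacency is an equivalence relation on \<open>N\<close>, this says that \<open>R\<close> picks a vertex of \<open>N\<close> in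
  every class, or in at least three of them.\<close>

definition represents :: "('a \<times> 'a) set \<Rightarrow> 'a set \<Rightarrow> 'a set \<Rightarrow> bool" where
  "represents E R N \<longleftrightarrow> (\<forall>v\<in>N. \<exists>w\<in>R \<inter> N. (v, w) \<notin> E) \<or>
     (\<exists>a\<in>R \<inter> N. \<exists>b\<in>R \<inter> N. \<exists>c\<in>R \<inter> N. (a, b) \<in> E \<and> (a, c) \<in> E \<and> (b, c) \<in> E)"

lemma represents_mono: "represents E R N \<Longrightarrow> R \<subseteq> R' \<Longrightarrow> represents E R' N"
  unfolding represents_def by blast

section \<open>Transfer of separations between the graph and the kept vertices\<close>

text \<open>Isolates what the kept set \<open>K\<close> must satisfy from how it is selected.
  Triples may repeat entries, so \<open>rep_triple\<close> also covers one or two neighbours in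
  \<open>X\<close>, and \<open>rep_all\<close> covers none.\<close>

locale co_cluster_kernel =
  fixes V :: "'a set" and E :: "('a \<times> 'a) set" and X K :: "'a set"
  assumes E_sym: "(u, v) \<in> E \<Longrightarrow> (v, u) \<in> E"
    and E_irrefl: "(v, v) \<notin> E"
    and XK: "X \<subseteq> K" and KV: "K \<subseteq> V"
    and nonadj_trans: "\<lbrakk>u \<in> V - X; v \<in> V - X; w \<in> V - X; (u, v) \<notin> E; (v, w) \<notin> E\<rbrakk> \<Longrightarrow> (u, w) \<notin> E"
    and rep_all: "represents E K (V - X)"
    and rep_triple: "\<lbrakk>x \<in> X; y \<in> X; z \<in> X\<rbrakk> \<Longrightarrow>
      represents E K {v \<in> V - X. (x, v) \<in> E \<and> (y, v) \<in> E \<and> (z, v) \<in> E}"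
begin

lemma separation_swap: "separation U E A B \<Longrightarrow> separation U E B A"
  unfolding separation_def by (auto dest: E_sym)

text \<open>With \<open>B\<close> inside \<open>X\<close>, a kept vertex outside \<open>X\<close>
  that is adjacent to \<open>B\<close> can only be in the cutset. The kept representatives of such
  neighbourhoods therefore show that the cutset tolerates the deleted vertices forced into
  it.\<close>

lemma separation_extend_one_sided:
  assumes sep: "separation K E A B" and HB: "B \<subseteq> X"
  shows "\<exists>A B. separation V E A B"
proof -
  let ?S = "K - (A \<union> B)"
  \<comment> \<open>A deleted vertex joins the cutset if it has a neighbour in \<open>B\<close>, and \<open>A\<close> otherwise.\<close>
  define N where "N = {v \<in> V - K. \<exists>x\<in>B. (x, v) \<in> E}"
  define A' where "A' = A \<union> (V - K - N)"
  have AB: "A \<subseteq> K" "B \<subseteq> K" "A \<inter> B = {}" "A \<noteq> {}" "B \<noteq> {}"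
    "\<And>a b. a \<in> A \<Longrightarrow> b \<in> B \<Longrightarrow> (a, b) \<notin> E" "\<And>u v. u \<in> ?S \<Longrightarrow> v \<in> ?S \<Longrightarrow> (u, v) \<notin> E"
    using sep unfolding separation_def by blast+
  have S_if: "w \<in> ?S" if "x \<in> B" "w \<in> K - X" "(x, w) \<in> E" for x w
    using AB(6)[of w x] HB E_sym[of x w] that by blast
  \<comment> \<open>By the triple \<open>x\<close>, \<open>x\<close>, \<open>x\<close>; three
    pairwise adjacent representatives are impossible because all of them would lie in the stable
    cutset.\<close>
  have rep: "\<exists>w\<in>?S - X. (v, w) \<notin> E" if v: "v \<in> N" for v
  proof -
    obtain x where x: "x \<in> B" "(x, v) \<in> E" using v by (auto simp: N_def)
    let ?T = "{v \<in> V - X. (x, v) \<in> E \<and> (x, v) \<in> E \<and> (x, v) \<in> E}"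
    have "represents E K ?T" using rep_triple x(1) HB by blast
    moreover have "v \<in> ?T" using v x XK by (auto simp: N_def)
    moreover have "K \<inter> ?T \<subseteq> ?S - X" using S_if[OF x(1)] by auto
    ultimately show ?thesis
      using AB(7) unfolding represents_def by (smt (verit) Int_iff subsetD DiffD1)
  qed
  have NS: "(v, y) \<notin> E" if v: "v \<in> N" and y: "y \<in> ?S" for v y
  proof (cases "y \<in> X")
    case True
    obtain x where x: "x \<in> B" "(x, v) \<in> E" using v by (auto simp: N_def)
    \<comment> \<open>Otherwise \<open>x\<close> and \<open>y\<close> have a kept common neighbour
      outside \<open>X\<close>. It is in the cutset because of \<open>x\<close>, yet adjacent to
      \<open>y\<close> in the cutset.\<close>
    show ?thesis
    proof
      assume "(v, y) \<in> E"
      then have "v \<in> {v \<in> V - X. (x, v) \<in> E \<and> (y, v) \<in> E \<and> (y, v) \<in> E}" (is "_ \<in> ?T")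
        using v x XK E_sym by (auto simp: N_def)
      moreover have "represents E K ?T" using rep_triple x(1) True HB by blast
      ultimately obtain w where w: "w \<in> K \<inter> ?T" unfolding represents_def by blast
      then have "w \<in> ?S" using S_if[OF x(1)] by blast
      with w y AB(7) show False by blast
    qed
  next
    case False
    obtain w where w: "w \<in> ?S - X" "(v, w) \<notin> E" using rep[OF v] by blast
    show ?thesis
      using nonadj_trans[of v w y] w y False v AB(7)[of w y] KV XK by (auto simp: N_def)
  qed
  have NN: "(v, v') \<notin> E" if v: "v \<in> N" "v' \<in> N" for v v'
  proof -
    obtain w where w: "w \<in> ?S - X" "(v', w) \<notin> E" using rep[OF v(2)] by blast
    show ?thesis
      using nonadj_trans[of v w v'] w v NS[OF v(1), of w] E_sym KV XK by (auto simp: N_def)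
  qed
  have rest: "V - (A' \<union> B) = ?S \<union> N"
    using AB KV by (auto simp: A'_def N_def)
  have "separation V E A' B"
    unfolding separation_def rest
  proof (intro conjI ballI)
    fix u v assume "u \<in> ?S \<union> N" "v \<in> ?S \<union> N"
    then show "(u, v) \<notin> E" using AB(7) NS NN E_sym[of u v] by blast
  next
    fix a b assume "a \<in> A'" "b \<in> B"
    then show "(a, b) \<notin> E" using AB(6) E_sym by (auto simp: A'_def N_def)
  qed (use AB KV in \<open>auto simp: A'_def\<close>)
  then show ?thesis by blast
qed

text \<open>The non-adjacent \<open>a\<close> and \<open>b\<close> share a part, and kept vertices
  of any other part see both, so they are in the stable cutset. Hence \<open>K - X\<close> meets at
  most two parts, every part relevant to a deleted vertex is represented, and the colours of its
  kept neighbours decide where it goes.\<close>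

lemma separation_extend_two_sided:
  assumes sep: "separation K E A B" and a: "a \<in> A - X" and b: "b \<in> B - X"
  shows "\<exists>A B. separation V E A B"
proof -
  let ?S = "K - (A \<union> B)"
  have AB: "A \<subseteq> K" "B \<subseteq> K" "A \<inter> B = {}" "A \<noteq> {}" "B \<noteq> {}"
    "\<And>a b. a \<in> A \<Longrightarrow> b \<in> B \<Longrightarrow> (a, b) \<notin> E" "\<And>u v. u \<in> ?S \<Longrightarrow> v \<in> ?S \<Longrightarrow> (u, v) \<notin> E"
    using sep unfolding separation_def by blast+
  have ab: "(a, b) \<notin> E" "a \<in> V - X" "b \<in> V - X" "a \<in> K" "b \<in> K" using a b AB KV by auto
  have adj_both: "(a, h) \<in> E \<longleftrightarrow> (b, h) \<in> E" if "h \<in> V - X" for h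
    using nonadj_trans[of a b h] nonadj_trans[of b a h] ab E_sym[of b a] that by blast
  have S_if: "h \<in> ?S" if "h \<in> K - X" "(a, h) \<in> E" for h
    using that adj_both[of h] AB(6)[of a h] AB(6)[of h b] E_sym[of b h] KV a b by blast
  \<comment> \<open>At most one of three pairwise adjacent vertices lies in the part of
    \<open>a\<close>; the other two are adjacent to \<open>a\<close> and would both be in the
    cutset.\<close>
  have no_triangle: "\<not> (u \<in> K - X \<and> v \<in> K - X \<and> w \<in> K - X \<and> (u, v) \<in> E \<and> (u, w) \<in> E \<and> (v, w) \<in> E)"
    for u v w
  proof
    assume *: "u \<in> K - X \<and> v \<in> K - X \<and> w \<in> K - X \<and> (u, v) \<in> E \<and> (u, w) \<in> E \<and> (v, w) \<in> E"
    then have "\<not> ((a, u) \<notin> E \<and> (a, v) \<notin> E)" "\<not> ((a, u) \<notin> E \<and> (a, w) \<notin> E)" "\<not> ((a, v) \<notin> E \<and> (a, w) \<notin> E)"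
      using nonadj_trans[of u a v] nonadj_trans[of u a w] nonadj_trans[of v a w]
        E_sym[of u a] E_sym[of v a] ab(2) KV
      by blast+
    then show False using * S_if AB(7) by meson
  qed
  have rep: "\<exists>w\<in>R \<inter> K. (v, w) \<notin> E" if "represents E K R" "R \<subseteq> V - X" "v \<in> R" for R v
    using that no_triangle KV unfolding represents_def
    by (smt (verit) DiffD2 DiffI Int_commute Int_iff subsetD)
  \<comment> \<open>A kept vertex of the same part stands in for \<open>v\<close>. Three neighbours
    are prescribed because that many suffice to show all three colours.\<close>
  have twin: "\<exists>w\<in>K - X. (v, w) \<notin> E \<and> (p, w) \<in> E \<and> (q, w) \<in> E \<and> (r, w) \<in> E"
    if v: "v \<in> V - K" and K: "p \<in> K" "q \<in> K" "r \<in> K" and adj: "(p, v) \<in> E" "(q, v) \<in> E" "(r, v) \<in> E"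
    for v p q r
  proof -
    have "\<exists>R. represents E K R \<and> R \<subseteq> V - X \<and> v \<in> R \<and>
        (\<forall>w\<in>R. \<forall>x\<in>{p, q, r} \<inter> X. (x, w) \<in> E)"
    proof (cases "{p, q, r} \<inter> X = {}")
      case True
      with rep_all v XK show ?thesis by (intro exI[of _ "V - X"]) auto
    next
      case False
      then obtain x where x: "x \<in> {p, q, r} \<inter> X" by blast
      \<comment> \<open>Neighbours outside \<open>X\<close> impose nothing beyond the part, so they are replaced by \<open>x\<close>.\<close>
      let ?f = "\<lambda>y. if y \<in> X then y else x"
      let ?R = "{v \<in> V - X. (?f p, v) \<in> E \<and> (?f q, v) \<in> E \<and> (?f r, v) \<in> E}"
      have "represents E K ?R" using x by (intro rep_triple) auto
      moreover have "v \<in> ?R" using v x adj XK by auto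
      ultimately show ?thesis by (intro exI[of _ ?R]) auto
    qed
    then obtain R where R: "represents E K R" "R \<subseteq> V - X" "v \<in> R"
      "\<forall>w\<in>R. \<forall>x\<in>{p, q, r} \<inter> X. (x, w) \<in> E" by blast
    from rep[OF R(1-3)] obtain w where w: "w \<in> R" "w \<in> K" "(v, w) \<notin> E" by blast
    have "(y, w) \<in> E" if "y \<in> {p, q, r}" for y
    proof (cases "y \<in> X")
      case True
      with R(4) w that show ?thesis by blast
    next
      case False
      then have "y \<in> V - X" using that K KV by auto
      moreover have "(y, v) \<in> E" using that adj by auto
      ultimately show ?thesis using nonadj_trans[of y w v] w R(2,3) E_sym[of w v] by blast
    qed
    with w R(2) show ?thesis by blast
  qed
  \<comment> \<open>The twin of such a \<open>v\<close> is kept, but its neighbours in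
    \<open>A\<close>, in \<open>B\<close> and in the cutset exclude it from all three.\<close>
  have not_rainbow: False
    if vpqr: "v \<in> V - K" "p \<in> A" "q \<in> B" "r \<in> ?S" "(p, v) \<in> E" "(q, v) \<in> E" "(r, v) \<in> E" for v p q r
  proof -
    have "p \<in> K" "q \<in> K" "r \<in> K" using vpqr AB by auto
    then obtain w where w: "w \<in> K" "(p, w) \<in> E" "(q, w) \<in> E" "(r, w) \<in> E"
      using twin[OF vpqr(1) _ _ _ vpqr(5-7)] by blast
    have "w \<notin> B" using AB(6)[OF vpqr(2)] w(2) by blast
    moreover have "w \<notin> A" using AB(6)[OF _ vpqr(3)] E_sym[OF w(3)] by blast
    ultimately show False using AB(7)[OF vpqr(4)] w(1,4) by blast
  qed
  define NA where "NA = {v \<in> V - K. \<exists>x\<in>A. (x, v) \<in> E}"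
  define NB where "NB = {v \<in> V - K. \<exists>x\<in>B. (x, v) \<in> E}"
  \<comment> \<open>A deleted vertex without neighbours in \<open>B\<close> joins \<open>A\<close>,
    one with neighbours in \<open>B\<close> but not in \<open>A\<close> joins \<open>B\<close>, and
    one with both joins the cutset.\<close>
  define A' where "A' = A \<union> (V - K - NB)"
  define B' where "B' = B \<union> (NB - NA)"
  \<comment> \<open>Of two adjacent deleted vertices, one is outside the part of \<open>a\<close>,
    so it sees \<open>a\<close> and \<open>b\<close> and joins the cutset. Its kept twin is in the
    cutset and adjacent to the other vertex, which by \<open>not_rainbow\<close> cannot see both
    sides as well.\<close>
  have opp: "(u \<in> NA \<inter> NB \<and> v \<notin> NA \<inter> NB) \<or> (v \<in> NA \<inter> NB \<and> u \<notin> NA \<inter> NB)"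
    if uv: "u \<in> V - K" "v \<in> V - K" "(u, v) \<in> E" for u v
  proof -
    have one: "u \<in> NA \<inter> NB \<and> v \<notin> NA \<inter> NB"
      if uv: "u \<in> V - K" "v \<in> V - K" "(u, v) \<in> E" and au: "(a, u) \<in> E" for u v
    proof -
      have uv': "u \<in> V - X" "v \<in> V - X" using uv XK by auto
      have u: "u \<in> NA \<inter> NB"
        using au adj_both[OF uv'(1)] a b uv(1) by (auto simp: NA_def NB_def)
      obtain w where w: "w \<in> K - X" "(u, w) \<notin> E" "(a, w) \<in> E"
        using twin[OF uv(1) ab(4) ab(4) ab(4) au au au] by blast
      have "(w, v) \<in> E"
        using nonadj_trans[of u w v] w uv' uv(3) KV by blast
      with S_if[of w] w uv not_rainbow[of v _ _ w] have "v \<notin> NA \<inter> NB"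
        by (auto simp: NA_def NB_def)
      with u show ?thesis by blast
    qed
    have "(a, u) \<in> E \<or> (a, v) \<in> E"
      using nonadj_trans[of u a v] uv ab XK E_sym[of u a] by blast
    then show ?thesis using one[of u v] one[of v u] uv E_sym[of u v] by blast
  qed
  have rest: "V - (A' \<union> B') = ?S \<union> (NA \<inter> NB)"
    using AB KV by (auto simp: A'_def B'_def NA_def NB_def)
  have "separation V E A' B'"
    unfolding separation_def rest
  proof (intro conjI ballI)
    fix u v assume "u \<in> ?S \<union> NA \<inter> NB" "v \<in> ?S \<union> NA \<inter> NB"
    moreover have "(u, v) \<notin> E" if "u \<in> NA \<inter> NB" "v \<in> ?S" for u v
      using not_rainbow[of u _ _ v] that E_sym[of u v] by (auto simp: NA_def NB_def)
    moreover have "(u, v) \<notin> E" if "u \<in> NA \<inter> NB" "v \<in> NA \<inter> NB" for u v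
      using opp[of u v] that by (auto simp: NA_def)
    ultimately show "(u, v) \<notin> E" using AB(7) E_sym[of u v] by blast
  next
    fix u v assume uv: "u \<in> A'" "v \<in> B'"
    have "(u, v) \<notin> E" if "u \<in> V - K - NB" "v \<in> NB - NA"
      using opp[of u v] that by (auto simp: NB_def)
    moreover have "(u, v) \<notin> E" if "u \<in> V - K - NB" "v \<in> B"
      using E_sym[of u v] that by (auto simp: NB_def)
    moreover have "(u, v) \<notin> E" if "u \<in> A" "v \<in> NB - NA"
      using that by (auto simp: NB_def NA_def)
    ultimately show "(u, v) \<notin> E" using uv AB(6) by (auto simp: A'_def B'_def)
  qed (use AB KV in \<open>auto simp: A'_def B'_def NB_def\<close>)
  then show ?thesis by blast
qed

lemma separation_extend:
  assumes sep: "separation K E A B"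
  shows "\<exists>A B. separation V E A B"
proof (cases "A \<subseteq> X \<or> B \<subseteq> X")
  case True
  then show ?thesis
    using separation_extend_one_sided[OF sep] separation_extend_one_sided[OF separation_swap[OF sep]]
    by blast
next
  case False
  then show ?thesis using separation_extend_two_sided[OF sep] by blast
qed

text \<open>If \<open>v\<close> has a non-neighbour in \<open>U\<close>, the neighbours of
  \<open>v\<close> in \<open>U\<close> form the cutset. Otherwise \<open>U - {v}\<close> is stable,
  and \<open>{v}\<close> is a cutset as at least two vertices remain.\<close>

lemma separation_star:
  assumes v: "v \<in> U" and stable: "\<And>u w. (v, u) \<in> E \<Longrightarrow> (v, w) \<in> E \<Longrightarrow> (u, w) \<notin> E"
    and U: "finite U" "3 \<le> card U"
  shows "\<exists>A B. separation U E A B"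
proof (cases "\<exists>u\<in>U - {v}. (v, u) \<notin> E")
  case True
  then have "separation U E {v} {u \<in> U - {v}. (v, u) \<notin> E}"
    unfolding separation_def using v stable by auto
  then show ?thesis by blast
next
  case False
  have "2 \<le> card (U - {v})" using U v by simp
  then obtain a b where ab: "a \<in> U - {v}" "b \<in> U - {v}" "a \<noteq> b"
    by (metis U(1) card_le_Suc0_iff_eq finite_Diff not_less_eq_eq numeral_2_eq_2)
  have "U - ({a} \<union> (U - {v, a})) = {v}" using v ab by auto
  moreover have "(a, c) \<notin> E" if "c \<in> U - {v, a}" for c
    using stable[of a c] False that ab by blast
  ultimately have "separation U E {a} (U - {v, a})"
    unfolding separation_def using ab E_irrefl by auto
  then show ?thesis by blast
qed

text \<open>If some vertex has a stable neighbourhood, a kept one yields a separation by itself,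
  unless \<open>K = V\<close>. Otherwise every vertex lies in a triangle, which forces both sides of
  the given separation to meet \<open>K\<close>.\<close>

lemma separation_restrict:
  assumes sep: "separation V E A B" and fin: "finite V"
    and stable: "(\<exists>v\<in>V. \<forall>u w. (v, u) \<in> E \<longrightarrow> (v, w) \<in> E \<longrightarrow> (u, w) \<notin> E) \<Longrightarrow>
      (\<exists>v\<in>K. \<forall>u w. (v, u) \<in> E \<longrightarrow> (v, w) \<in> E \<longrightarrow> (u, w) \<notin> E)"
    and EV: "E \<subseteq> V \<times> V"
    and large: "K = V \<or> 3 \<le> card K"
  shows "\<exists>A B. separation K E A B"
proof (cases "\<exists>v\<in>V. \<forall>u w. (v, u) \<in> E \<longrightarrow> (v, w) \<in> E \<longrightarrow> (u, w) \<notin> E")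
  case True
  show ?thesis
  proof (cases "K = V")
    case True
    with sep show ?thesis by blast
  next
    case False
    then show ?thesis
      using stable[OF True] separation_star[of _ K] large finite_subset[OF KV fin] by metis
  qed
next
  case False
  \<comment> \<open>A triangle at \<open>a \<in> A\<close> cannot have its other two vertices in the
    stable cutset, so \<open>A\<close> contains an edge, outside \<open>X\<close>. Its ends lie in
    different parts, and a vertex of \<open>B\<close> outside \<open>X\<close> would be non-adjacent
    to both; hence \<open>B \<subseteq> X\<close>. An edge of \<open>K - X\<close> then has an end
    in \<open>A\<close>.\<close>
  have both: "A \<inter> K \<noteq> {} \<and> B \<inter> K \<noteq> {}" if sep: "separation V E A B" and AX: "A \<inter> X = {}" for A B
  proof -
    have AB: "A \<subseteq> V" "B \<subseteq> V" "A \<noteq> {}" "B \<noteq> {}"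
      "\<And>a b. a \<in> A \<Longrightarrow> b \<in> B \<Longrightarrow> (a, b) \<notin> E"
      "\<And>u v. u \<in> V - (A \<union> B) \<Longrightarrow> v \<in> V - (A \<union> B) \<Longrightarrow> (u, v) \<notin> E"
      using sep unfolding separation_def by blast+
    obtain a where a: "a \<in> A" using AB by blast
    then obtain u w where uw: "(a, u) \<in> E" "(a, w) \<in> E" "(u, w) \<in> E"
      using False AB by blast
    then have "u \<in> A \<or> w \<in> A" using AB(6)[of u w] AB(5)[of a] a EV by blast
    then obtain c where c: "c \<in> A" "(a, c) \<in> E" using uw by blast
    have H: "a \<in> V - X" "c \<in> V - X" using a c AB AX by auto
    have BH: "B \<subseteq> X"
    proof
      fix h assume h: "h \<in> B"
      then have "(a, h) \<notin> E" "(h, c) \<notin> E" using AB(5) a c E_sym[of h c] by blast+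
      with nonadj_trans[of a h c] H c h AB show "h \<in> X" by blast
    qed
    \<comment> \<open>Either the distinct parts of \<open>a\<close> and \<open>c\<close> both have
      kept vertices, which are adjacent, or three pairwise adjacent vertices are kept.\<close>
    have "\<exists>u\<in>K - X. \<exists>w\<in>K - X. (u, w) \<in> E"
      using rep_all unfolding represents_def
    proof
      assume *: "\<forall>v\<in>V - X. \<exists>w\<in>K \<inter> (V - X). (v, w) \<notin> E"
      obtain u w where "u \<in> K \<inter> (V - X)" "w \<in> K \<inter> (V - X)" "(a, u) \<notin> E" "(c, w) \<notin> E"
        using * H by meson
      moreover from this have "(u, w) \<in> E"
        using nonadj_trans[of a u w] nonadj_trans[of a w c] H c E_sym[of w c] by blast
      ultimately show ?thesis by blast
    qed blast
    then obtain u w where "u \<in> K - X" "w \<in> K - X" "(u, w) \<in> E" by blast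
    with AB(6)[of u w] BH KV have "A \<inter> K \<noteq> {}" by blast
    with BH AB XK show ?thesis by blast
  qed
  \<comment> \<open>A side meeting \<open>X\<close> meets \<open>K\<close>; if a side misses
    \<open>X\<close>, \<open>both\<close> handles the two sides at once.\<close>
  have "A \<inter> K \<noteq> {} \<and> B \<inter> K \<noteq> {}"
    using both[OF sep] both[OF separation_swap[OF sep]] XK by blast
  then have "separation K E (A \<inter> K) (B \<inter> K)"
    using sep KV unfolding separation_def by blast
  then show ?thesis by blast
qed

end

section \<open>Time-bounded execution\<close>

text \<open>Total correctness with a time bound. Execution is deterministic, so the existential
  speaks of the only halting run.\<close>

definition runs :: "com \<Rightarrow> ram_state \<Rightarrow> nat \<Rightarrow> (ram_state \<Rightarrow> bool) \<Rightarrow> bool" where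
  "runs c s T Q \<longleftrightarrow> (\<exists>t s'. exec c s t s' \<and> t \<le> T \<and> Q s')"

lemma runs_conseq:
  "\<lbrakk>runs c s T Q; T \<le> T'; \<And>s'. Q s' \<Longrightarrow> Q' s'\<rbrakk> \<Longrightarrow> runs c s T' Q'"
  unfolding runs_def by (meson le_trans)

lemma runs_le: "\<lbrakk>runs c s T Q; T \<le> T'\<rbrakk> \<Longrightarrow> runs c s T' Q"
  using runs_conseq by blast

lemma runs_basic:
  "Q s \<Longrightarrow> runs Skip s 1 Q"
  "Q (s\<lparr>reg := (reg s)(i := k)\<rparr>) \<Longrightarrow> runs (Const i k) s 1 Q"
  "Q (s\<lparr>reg := (reg s)(i := reg s j + reg s k)\<rparr>) \<Longrightarrow> runs (Add i j k) s 1 Q"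
  "Q (s\<lparr>reg := (reg s)(i := reg s j - reg s k)\<rparr>) \<Longrightarrow> runs (Sub i j k) s 1 Q"
  "Q (s\<lparr>reg := (reg s)(i := mem s (reg s j))\<rparr>) \<Longrightarrow> runs (Load i j) s 1 Q"
  "Q (s\<lparr>out := out s @ [reg s i]\<rparr>) \<Longrightarrow> runs (Write i) s 1 Q"
  unfolding runs_def by (blast intro: exec.intros)+

lemma runs_Seq: "runs c s T (\<lambda>s'. runs d s' U Q) \<Longrightarrow> runs (Seq c d) s (T + U) Q"
  unfolding runs_def by (meson add_mono exec.Seq)

text \<open>The bounds of the branches are added, since a maximum of polynomials need not be a
  polynomial.\<close>

lemma runs_If:
  "\<lbrakk>reg s i \<noteq> 0 \<Longrightarrow> runs c s T Q; reg s i = 0 \<Longrightarrow> runs d s U Q\<rbrakk> \<Longrightarrow> runs (If i c d) s (T + U + 1) Q"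
  unfolding runs_def by (cases "reg s i = 0") (fastforce intro: exec.intros)+

text \<open>The index of the invariant is the variant: it bounds the remaining iterations. Each is
  charged \<open>T + 1\<close> for body and test, and the failing test costs 1.\<close>

lemma runs_While:
  assumes "I k s"
    and "\<And>k s. I k s \<Longrightarrow> reg s i \<noteq> 0 \<Longrightarrow> runs c s T (\<lambda>s'. \<exists>j<k. I j s')"
  shows "runs (While i c) s (k * (T + 1) + 1) (\<lambda>s'. reg s' i = 0 \<and> (\<exists>j. I j s'))"
  using assms(1)
proof (induction k arbitrary: s rule: less_induct)
  case (less k)
  show ?case
  proof (cases "reg s i = 0")
    case True
    with less.prems show ?thesis
      unfolding runs_def by (intro exI[of _ 1] exI[of _ s]) (auto intro: exec.WhileFalse[simplified])
  next
    case False
    from assms(2)[OF less.prems False] obtain t s' j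
      where 1: "exec c s t s'" "t \<le> T" "j < k" "I j s'"
      unfolding runs_def by blast
    from less.IH[OF 1(3,4)] obtain u s'' where 2: "exec (While i c) s' u s''"
      "u \<le> j * (T + 1) + 1" "reg s'' i = 0" "\<exists>j. I j s''"
      unfolding runs_def by blast
    have "(j + 1) * (T + 1) \<le> k * (T + 1)" using 1(3) by (intro mult_right_mono) auto
    with 1(2) 2(2) have "t + u + 1 \<le> k * (T + 1) + 1" by simp
    then show ?thesis
      unfolding runs_def using exec.WhileTrue[OF False 1(1) 2(1)] 2(3,4) by blast
  qed
qed

section \<open>Compiling first-order formulas\<close>

text \<open>Variables are de Bruijn levels: a quantifier at depth \<open>d\<close> binds variable \<open>d\<close>. The semantics reads
  the input directly from the memory \<open>m\<close>, laid out as by \<^const>\<open>encode\<close>.\<close>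

datatype fm = Adj nat nat | InX nat | Less nat nat | Neg fm | Conj fm fm | Ex fm

primrec wf_fm :: "fm \<Rightarrow> nat \<Rightarrow> bool" where
  "wf_fm (Adj i j) d \<longleftrightarrow> i < d \<and> j < d"
| "wf_fm (InX i) d \<longleftrightarrow> i < d"
| "wf_fm (Less i j) d \<longleftrightarrow> i < d \<and> j < d"
| "wf_fm (Neg f) d \<longleftrightarrow> wf_fm f d"
| "wf_fm (Conj f g) d \<longleftrightarrow> wf_fm f d \<and> wf_fm g d"
| "wf_fm (Ex f) d \<longleftrightarrow> wf_fm f (Suc d)"

primrec sem :: "(nat \<Rightarrow> nat) \<Rightarrow> nat \<Rightarrow> fm \<Rightarrow> nat \<Rightarrow> (nat \<Rightarrow> nat) \<Rightarrow> bool" where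
  "sem m n (Adj i j) d e \<longleftrightarrow> m (1 + n + e i * n + e j) \<noteq> 0"
| "sem m n (InX i) d e \<longleftrightarrow> m (1 + e i) \<noteq> 0"
| "sem m n (Less i j) d e \<longleftrightarrow> e i < e j"
| "sem m n (Neg f) d e \<longleftrightarrow> \<not> sem m n f d e"
| "sem m n (Conj f g) d e \<longleftrightarrow> sem m n f d e \<and> sem m n g d e"
| "sem m n (Ex f) d e \<longleftrightarrow> (\<exists>i<n. sem m n f (Suc d) (e(d := i)))"

lemma sem_cong:
  "wf_fm f d \<Longrightarrow> (\<And>i. i < d \<Longrightarrow> e i = e' i) \<Longrightarrow> sem m n f d e \<longleftrightarrow> sem m n f d e'"
proof (induction f arbitrary: d e e')
  case (Ex f)
  have "sem m n f (Suc d) (e(d := i)) \<longleftrightarrow> sem m n f (Suc d) (e'(d := i))" for i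
    using Ex.prems by (intro Ex.IH) auto
  then show ?case by simp
next
  case (Conj f g)
  then show ?case by (metis sem.simps(5) wf_fm.simps(5))
next
  case (Neg f)
  then show ?case by (metis sem.simps(4) wf_fm.simps(4))
qed auto

text \<open>Register conventions: 0 holds the number of vertices, 1 the constant one, 2 the truth value computed
  (non-zero for true), 3 and 4 are scratch, 7 counts kept vertices, and \<open>8 + i\<close> holds variable \<open>i\<close>.\<close>

primrec compile :: "fm \<Rightarrow> nat \<Rightarrow> com" where
  "compile (Adj i j) d =
     Seq (Const 3 0) (Seq (Add 4 (8 + i) 3) (Seq (Add 2 (8 + j) 1) (Seq (Add 2 2 0)
     (Seq (While 4 (Seq (Add 2 2 0) (Sub 4 4 1))) (Load 2 2)))))"
| "compile (InX i) d = Seq (Add 2 (8 + i) 1) (Load 2 2)"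
| "compile (Less i j) d = Sub 2 (8 + j) (8 + i)"
| "compile (Neg f) d = Seq (compile f d) (If 2 (Const 2 0) (Const 2 1))"
| "compile (Conj f g) d = Seq (compile f d) (If 2 (compile g d) Skip)"
| "compile (Ex f) d =
     Seq (Const (8 + d) 0) (Seq (Const 2 0) (Seq (Sub 3 0 (8 + d))
     (While 3 (Seq (compile f (Suc d))
       (If 2 (Const 3 0) (Seq (Add (8 + d) (8 + d) 1) (Sub 3 0 (8 + d))))))))"

text \<open>A frame condition: besides output and counter, only the registers 2, 3, 4 and those of
  variables from level \<open>d\<close> on may change. Output and counter are recorded as increments
  so that effects compose.\<close>

definition effect :: "nat \<Rightarrow> ram_state \<Rightarrow> nat list \<Rightarrow> nat \<Rightarrow> ram_state \<Rightarrow> bool" where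
  "effect d s w c s' \<longleftrightarrow> mem s' = mem s \<and> out s' = out s @ w \<and> reg s' 7 = reg s 7 + c \<and>
     (\<forall>j<8 + d. j \<notin> {2, 3, 4, 7} \<longrightarrow> reg s' j = reg s j)"

lemma effect_trans:
  "effect d s w c s' \<Longrightarrow> effect d s' w' c' s'' \<Longrightarrow> effect d s (w @ w') (c + c') s''"
  unfolding effect_def by simp

lemma effect_trans_silent:
  "effect d s [] 0 s' \<Longrightarrow> effect d s' w c s'' \<Longrightarrow> effect d s w c s''"
  using effect_trans by fastforce

lemma effect_le: "effect d s w c s' \<Longrightarrow> d' \<le> d \<Longrightarrow> effect d' s w c s'"
  unfolding effect_def by simp

lemma effect_reg:
  assumes "effect d s w c s'"
  shows "mem s' = mem s" "reg s' 0 = reg s 0" "reg s' (Suc 0) = reg s (Suc 0)"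
    "i < d \<Longrightarrow> reg s' (8 + i) = reg s (8 + i)"
  using assms unfolding effect_def by auto

definition ready :: "nat \<Rightarrow> ram_state \<Rightarrow> bool" where
  "ready d s \<longleftrightarrow> reg s 1 = 1 \<and> (\<forall>i<d. reg s (8 + i) < reg s 0)"

lemma ready_effect: "effect d s w c s' \<Longrightarrow> ready d s' \<longleftrightarrow> ready d s"
  unfolding effect_def ready_def by auto

definition decides :: "fm \<Rightarrow> nat \<Rightarrow> ram_state \<Rightarrow> ram_state \<Rightarrow> bool" where
  "decides f d s s' \<longleftrightarrow> effect d s [] 0 s' \<and>
     (reg s' 2 \<noteq> 0 \<longleftrightarrow> sem (mem s) (reg s 0) f d (\<lambda>i. reg s (8 + i)))"

text \<open>The polynomial is fixed before the state, so it depends on the formula only. A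
  quantifier contributes a factor \<open>n\<close> for its search through all vertices.\<close>

lemma compile_correct:
  assumes "wf_fm f d"
  shows "\<exists>p. \<forall>s. ready d s \<longrightarrow> runs (compile f d) s (poly p (reg s 0))
    (decides f d s)"
  using assms
proof (induction f arbitrary: d)
  case (Adj i j)
  have "runs (compile (Adj i j) d) s (poly [:9, 3:] (reg s 0))
    (decides (Adj i j) d s)"
    if s: "ready d s" for s
  proof -
    \<comment> \<open>There is no multiplication instruction: the row offset accumulates in register
      2, and \<open>k\<close> rows are still to be added.\<close>
    define I where "I k s' \<longleftrightarrow> effect d s [] 0 s' \<and> reg s' 4 = k \<and> k \<le> reg s (8 + i) \<and>
      reg s' 2 = 1 + reg s 0 + (reg s (8 + i) - k) * reg s 0 + reg s (8 + j)" for k s'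
    have step: "runs (Seq (Add 2 2 0) (Sub 4 4 1)) s' (1 + 1) (\<lambda>s'. \<exists>l<k. I l s')"
      if "I k s'" "reg s' 4 \<noteq> 0" for k s'
    proof (rule runs_Seq, rule runs_basic, rule runs_basic, rule exI[of _ "k - 1"])
      have "reg s (8 + i) - (k - 1) = Suc (reg s (8 + i) - k)"
        using that by (auto simp: I_def)
      then show "k - 1 < k \<and> I (k - 1) (s'\<lparr>reg := (reg s')(2 := reg s' 2 + reg s' 0)\<rparr>
        \<lparr>reg := (reg (s'\<lparr>reg := (reg s')(2 := reg s' 2 + reg s' 0)\<rparr>))
          (4 := reg (s'\<lparr>reg := (reg s')(2 := reg s' 2 + reg s' 0)\<rparr>) 4 -
            reg (s'\<lparr>reg := (reg s')(2 := reg s' 2 + reg s' 0)\<rparr>) 1)\<rparr>)"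
        using that s by (auto simp: I_def effect_def ready_def)
    qed
    have loop: "runs (While 4 (Seq (Add 2 2 0) (Sub 4 4 1))) s' (reg s 0 * 3 + 1)
        (\<lambda>s'. reg s' 4 = 0 \<and> (\<exists>k. I k s'))" if "I (reg s (8 + i)) s'" for s'
    proof (rule runs_conseq[OF runs_While[of I "reg s (8 + i)" s' 4 _ "1 + 1"]])
      show "I (reg s (8 + i)) s'" by fact
      have "reg s (8 + i) < reg s 0" using s Adj.prems by (auto simp: ready_def)
      then show "reg s (8 + i) * (1 + 1 + 1) + 1 \<le> reg s 0 * 3 + 1" by simp
    qed (use step in auto)
    show ?thesis
      unfolding compile.simps decides_def
    proof (rule runs_le[where T = "1 + (1 + (1 + (1 + ((reg s 0 * 3 + 1) + 1))))"],
        (rule runs_Seq, rule runs_basic)+, rule runs_Seq,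
        rule runs_conseq[OF loop order.refl], goal_cases)
      case 1
      then show ?case using Adj.prems s by (simp add: I_def effect_def ready_def)
    next
      case (2 s')
      then have "effect d s [] 0 s'"
        "reg s' 2 = 1 + reg s 0 + reg s (8 + i) * reg s 0 + reg s (8 + j)"
        by (auto simp: I_def)
      then show ?case by (intro runs_basic) (auto simp: effect_def)
    qed simp
  qed
  then show ?case by blast
next
  case (InX i)
  have "runs (compile (InX i) d) s (poly [:2:] (reg s 0))
    (decides (InX i) d s)"
    if s: "ready d s" for s
    unfolding compile.simps decides_def
    by (rule runs_le, rule runs_Seq, rule runs_basic, rule runs_basic)
      (use s in \<open>auto simp: effect_def ready_def\<close>)
  then show ?case by blast
next
  case (Less i j)
  have "runs (compile (Less i j) d) s (poly [:1:] (reg s 0))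
    (decides (Less i j) d s)" for s
    unfolding compile.simps decides_def
    by (rule runs_le, rule runs_basic) (auto simp: effect_def)
  then show ?case by blast
next
  case (Neg f)
  then obtain p where p: "ready d s \<Longrightarrow> runs (compile f d) s (poly p (reg s 0))
    (decides f d s)" for s
    by force
  have "runs (compile (Neg f) d) s (poly (p + [:3:]) (reg s 0))
    (decides (Neg f) d s)"
    if s: "ready d s" for s
    unfolding compile.simps decides_def
    by (rule runs_le, rule runs_Seq, rule runs_conseq[OF p[OF s] order.refl],
        (rule runs_If; rule runs_basic)) (auto simp: decides_def effect_def)
  then show ?case by blast
next
  case (Conj f g)
  then obtain p q where p: "ready d s \<Longrightarrow> runs (compile f d) s (poly p (reg s 0))
    (decides f d s)"
    and q: "ready d s \<Longrightarrow> runs (compile g d) s (poly q (reg s 0))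
    (decides g d s)" for s
    by force
  have "runs (compile (Conj f g) d) s (poly (p + q + [:2:]) (reg s 0))
    (decides (Conj f g) d s)"
    if s: "ready d s" for s
    unfolding compile.simps decides_def
  proof (rule runs_le[where T = "poly p (reg s 0) + (poly q (reg s 0) + 1 + 1)"], rule runs_Seq,
      rule runs_conseq[OF p[OF s] order.refl], rule runs_If, goal_cases)
    case (1 s')
    then have e: "effect d s [] 0 s'" "sem (mem s) (reg s 0) f d (\<lambda>i. reg s (8 + i))"
      by (auto simp: decides_def)
    have "sem (mem s') (reg s' 0) g d (\<lambda>i. reg s' (8 + i)) \<longleftrightarrow>
        sem (mem s) (reg s 0) g d (\<lambda>i. reg s (8 + i))"
      using Conj.prems effect_reg[OF e(1)]
      by (simp add: sem_cong[of g d "\<lambda>i. reg s' (8 + i)" "\<lambda>i. reg s (8 + i)"])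
    moreover have "ready d s'" using ready_effect[OF e(1)] s by simp
    ultimately show ?case
      using e effect_trans_silent[OF e(1)]
      by (intro runs_conseq[OF q, where T' = "poly q (reg s 0)"]) (auto simp: effect_reg decides_def)
  next
    case (2 s')
    then show ?case by (intro runs_basic) (auto simp: decides_def)
  qed simp
  then show ?case by blast
next
  case (Ex f)
  then obtain p where p: "ready (Suc d) s \<Longrightarrow> runs (compile f (Suc d)) s (poly p (reg s 0))
    (decides f (Suc d) s)" for s
    by force
  have "runs (compile (Ex f) d) s (poly ([:0, 1:] * (p + [:5:]) + [:4:]) (reg s 0))
    (decides (Ex f) d s)"
    if s: "ready d s" for s
  proof -
    define n where "n = reg s 0"
    define P where "P k \<longleftrightarrow> sem (mem s) n f (Suc d) ((\<lambda>i. reg s (8 + i))(d := k))" for k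
    \<comment> \<open>Either all candidates so far have failed, or a witness was found and the guard
      register 3 was zeroed to leave the loop. Evaluating \<open>f\<close> may overwrite register 3,
      so both branches set it anew.\<close>
    define I where "I k s' \<longleftrightarrow> effect d s [] 0 s' \<and>
      (reg s' (8 + d) \<le> n \<and> (\<forall>v<reg s' (8 + d). \<not> P v) \<and>
        reg s' 3 = n - reg s' (8 + d) \<and> k = n - reg s' (8 + d) \<and> reg s' 2 = 0 \<or>
       (\<exists>v<n. P v) \<and> reg s' 3 = 0 \<and> reg s' 2 \<noteq> 0 \<and> k = 0)" for k s'
    have step: "runs (Seq (compile f (Suc d))
        (If 2 (Const 3 0) (Seq (Add (8 + d) (8 + d) 1) (Sub 3 0 (8 + d))))) s'
        (poly p n + (1 + (1 + 1) + 1)) (\<lambda>s'. \<exists>l<k. I l s')"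
      if I: "I k s'" "reg s' 3 \<noteq> 0" for k s'
    proof -
      from I have e: "effect d s [] 0 s'" and v: "reg s' (8 + d) < n" "\<forall>v<reg s' (8 + d). \<not> P v"
        and k: "k = n - reg s' (8 + d)"
        by (auto simp: I_def)
      have "ready (Suc d) s'"
        using ready_effect[OF e] s effect_reg[OF e] v(1) by (auto simp: ready_def n_def less_Suc_eq)
      note run = p[OF this]
      have sem_eq: "sem (mem s') (reg s' 0) f (Suc d) (\<lambda>i. reg s' (8 + i)) \<longleftrightarrow> P (reg s' (8 + d))"
        unfolding P_def n_def effect_reg(1,2)[OF e]
        using Ex.prems effect_reg[OF e] by (intro sem_cong) (auto simp: less_Suc_eq)
      have n': "reg s' 0 = n" using effect_reg[OF e] by (simp add: n_def)
      show ?thesis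
      proof (rule runs_Seq, rule runs_conseq[OF run], simp add: n', rule runs_If, goal_cases)
        case (1 s'')
        then have e2: "effect (Suc d) s' [] 0 s''" and "P (reg s' (8 + d))" using sem_eq by (auto simp: decides_def)
        moreover have "effect d s [] 0 s''"
          using effect_trans_silent[OF e effect_le[OF e2]] by simp
        ultimately show ?case
          using 1 k v by (intro runs_basic exI[of _ 0]) (auto simp: I_def effect_def)
      next
        case (2 s'')
        then have e2: "effect (Suc d) s' [] 0 s''" and nP: "\<not> P (reg s' (8 + d))" using sem_eq by (auto simp: decides_def)
        have e3: "effect d s [] 0 s''"
          using effect_trans_silent[OF e effect_le[OF e2]] by simp
        have r: "reg s'' (8 + d) = reg s' (8 + d)" "reg s'' (Suc 0) = Suc 0" "reg s'' 0 = n"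
          using effect_reg[OF e2] effect_reg[OF e] s by (auto simp: ready_def n_def)
        have "\<forall>w<Suc (reg s' (8 + d)). \<not> P w" using v(2) nP by (auto simp: less_Suc_eq)
        then show ?case
          using 2 k v e3 r
          by (intro runs_Seq runs_basic exI[of _ "n - Suc (reg s' (8 + d))"])
            (auto simp: I_def effect_def)
      qed
    qed
    show ?thesis
      unfolding compile.simps decides_def
    proof (rule runs_le[where T = "1 + (1 + (1 + (n * (poly p n + (1 + (1 + 1) + 1) + 1) + 1)))"],
        (rule runs_Seq, rule runs_basic)+,
        rule runs_conseq[OF runs_While[of I n _ 3 _ "poly p n + (1 + (1 + 1) + 1)"] order.refl], goal_cases)
      case 1
      then show ?case by (simp add: I_def effect_def n_def)
    next
      case (2 k s')
      then show ?case by (rule step)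
    next
      case (3 s')
      then obtain j where "I j s'" "reg s' 3 = 0" by blast
      then show ?case by (auto simp: I_def P_def n_def)
    qed (simp add: n_def algebra_simps)
  qed
  then show ?case by blast
qed

section \<open>Loops over all vertices and the program that outputs an induced subgraph\<close>

text \<open>Register 2 holds the number of remaining iterations; bodies may overwrite it, so it is
  recomputed from the loop variable.\<close>

definition for_loop :: "nat \<Rightarrow> com \<Rightarrow> com" where
  "for_loop l c = Seq (Const (8 + l) 0) (Seq (Sub 2 0 (8 + l))
     (While 2 (Seq c (Seq (Add (8 + l) (8 + l) 1) (Sub 2 0 (8 + l))))))"

lemma runs_for_loop:
  assumes s: "ready l s"
    and body: "\<And>s'. \<lbrakk>ready (Suc l) s'; mem s' = mem s; reg s' 0 = reg s 0;
      \<And>i. i < l \<Longrightarrow> reg s' (8 + i) = reg s (8 + i)\<rbrakk> \<Longrightarrow>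
      runs c s' T (effect (Suc l) s' (f (reg s' (8 + l))) (g (reg s' (8 + l))))"
  shows "runs (for_loop l c) s (reg s 0 * (T + 3) + 3)
    (effect l s (concat (map f [0..<reg s 0])) (sum_list (map g [0..<reg s 0])))"
proof -
  define n where "n = reg s 0"
  define I where "I k s' \<longleftrightarrow> reg s' (8 + l) \<le> n \<and> k = n - reg s' (8 + l) \<and> reg s' 2 = k \<and>
    effect l s (concat (map f [0..<reg s' (8 + l)])) (sum_list (map g [0..<reg s' (8 + l)])) s'" for k s'
  have step: "runs (Seq c (Seq (Add (8 + l) (8 + l) 1) (Sub 2 0 (8 + l)))) s' (T + (1 + 1))
      (\<lambda>s'. \<exists>j<k. I j s')" if I: "I k s'" "reg s' 2 \<noteq> 0" for k s'
  proof -
    define v where "v = reg s' (8 + l)"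
    have v: "v < n" "k = n - v"
      and e: "effect l s (concat (map f [0..<v])) (sum_list (map g [0..<v])) s'"
      using I by (auto simp: I_def v_def)
    have "ready (Suc l) s'"
      using ready_effect[OF e] s effect_reg[OF e] v(1) by (auto simp: ready_def n_def v_def less_Suc_eq)
    then have run: "runs c s' T (effect (Suc l) s' (f v) (g v))"
      unfolding v_def using effect_reg[OF e] by (intro body) auto
    show ?thesis
    proof (rule runs_Seq, rule runs_conseq[OF run order.refl], rule runs_Seq, rule runs_basic,
        rule runs_basic, rule exI[of _ "n - Suc v"], goal_cases)
      case (1 s'')
      have r: "reg s'' (8 + l) = v" "reg s'' (Suc 0) = Suc 0" "reg s'' 0 = n"
        using effect_reg[OF 1] effect_reg[OF e] s by (auto simp: ready_def n_def v_def)
      have "effect l s (concat (map f [0..<Suc v])) (sum_list (map g [0..<Suc v])) s''"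
        using effect_trans[OF e effect_le[OF 1]] by simp
      then show ?case using v r by (auto simp: I_def effect_def)
    qed
  qed
  show ?thesis
    unfolding for_loop_def
  proof (rule runs_le[where T = "1 + (1 + (n * (T + (1 + 1) + 1) + 1))"],
      (rule runs_Seq, rule runs_basic)+,
      rule runs_conseq[OF runs_While[of I n _ 2 _ "T + (1 + 1)"] order.refl], goal_cases)
    case 1
    then show ?case by (simp add: I_def effect_def n_def)
  next
    case (2 k s')
    then show ?case by (rule step)
  next
    case (3 s')
    then obtain j where "I j s'" "reg s' 2 = 0" by blast
    then show ?case by (auto simp: I_def n_def)
  qed (simp add: n_def algebra_simps)
qed

definition guarded :: "fm \<Rightarrow> nat \<Rightarrow> com \<Rightarrow> com" where
  "guarded f d c = Seq (compile f d) (If 2 c Skip)"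

lemma runs_guarded:
  assumes "runs (compile f d) s T (decides f d s)"
    and "\<And>s'. effect d s [] 0 s' \<Longrightarrow> runs c s' U (effect d s' w k)"
    and "b \<longleftrightarrow> sem (mem s) (reg s 0) f d (\<lambda>i. reg s (8 + i))"
  shows "runs (guarded f d c) s (T + U + 2)
    (effect d s (if b then w else []) (if b then k else 0))"
  unfolding guarded_def
proof (rule runs_le[where T = "T + (U + 1 + 1)"], rule runs_Seq, rule runs_conseq[OF assms(1) order.refl],
    rule runs_If, goal_cases)
  case (1 s')
  then have e: "effect d s [] 0 s'" and b by (auto simp: decides_def assms(3))
  then show ?case using effect_trans_silent[OF e] by (intro runs_conseq[OF assms(2)]) auto
next
  case (2 s')
  then show ?case by (intro runs_basic) (auto simp: decides_def assms(3))
qed simp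

text \<open>The output cannot be revised, so the kept vertices are counted first.
  \<open>f\<^sub>0\<close> and \<open>f\<^sub>1\<close> express the same property for variable 0 at
  depth 1 and variable 1 at depth 2. All kept vertices are put into the new modulator, whose vector
  is all ones; in the last branch register 2 is zero.\<close>

definition subgraph_prog :: "fm \<Rightarrow> fm \<Rightarrow> com" where
  "subgraph_prog f\<^sub>0 f\<^sub>1 = Seq (Load 0 0) (Seq (Const 1 1)
     (Seq (for_loop 0 (guarded f\<^sub>0 1 (Add 7 7 1))) (Seq (Write 7)
     (Seq (for_loop 0 (guarded f\<^sub>0 1 (Write 1)))
       (for_loop 0 (guarded f\<^sub>0 1 (for_loop 1 (guarded f\<^sub>1 2
         (Seq (compile (Adj 0 1) 2) (If 2 (Write 1) (Write 2)))))))))))"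

definition subgraph_word :: "nat \<Rightarrow> (nat \<Rightarrow> bool) \<Rightarrow> (nat \<Rightarrow> nat \<Rightarrow> bool) \<Rightarrow> nat list" where
  "subgraph_word n K a = sum_list (map (\<lambda>i. if K i then 1 else 0) [0..<n]) #
     concat (map (\<lambda>i. if K i then [1] else []) [0..<n]) @
     concat (map (\<lambda>i. if K i then concat (map (\<lambda>j. if K j then [of_bool (a i j)] else []) [0..<n])
       else []) [0..<n])"

lemma runs_subgraph_prog:
  assumes "wf_fm f\<^sub>0 1" "wf_fm f\<^sub>1 2"
  shows "\<exists>p. \<forall>s K. reg s = (\<lambda>_. 0) \<longrightarrow> out s = [] \<longrightarrow>
    (\<forall>e. sem (mem s) (mem s 0) f\<^sub>0 1 e \<longleftrightarrow> K (e 0)) \<longrightarrow>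
    (\<forall>e. sem (mem s) (mem s 0) f\<^sub>1 2 e \<longleftrightarrow> K (e 1)) \<longrightarrow>
    runs (subgraph_prog f\<^sub>0 f\<^sub>1) s (poly p (mem s 0)) (\<lambda>s'. out s' =
      subgraph_word (mem s 0) K (\<lambda>i j. mem s (1 + mem s 0 + i * mem s 0 + j) \<noteq> 0))"
proof -
  obtain p\<^sub>0 p\<^sub>1 p\<^sub>2 where
    p0: "\<And>s. ready 1 s \<Longrightarrow> runs (compile f\<^sub>0 1) s (poly p\<^sub>0 (reg s 0)) (decides f\<^sub>0 1 s)" and
    p1: "\<And>s. ready 2 s \<Longrightarrow> runs (compile f\<^sub>1 2) s (poly p\<^sub>1 (reg s 0)) (decides f\<^sub>1 2 s)" and
    p2: "\<And>s. ready 2 s \<Longrightarrow> runs (compile (Adj 0 1) 2) s (poly p\<^sub>2 (reg s 0)) (decides (Adj 0 1) 2 s)"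
    using compile_correct[OF assms(1)] compile_correct[OF assms(2)] compile_correct[of "Adj 0 1" 2]
    by auto
  \<comment> \<open>\<open>q\<close> is the cost of one pass of the innermost loop. In
    \<open>p\<close>, 20 sums the overheads 6, 6 and 8 per pass of the three outer loops, and 12 is
    3 for each of them plus three single instructions.\<close>
  define q where "q = p\<^sub>1 + p\<^sub>2 + [:8:]"
  define p where "p = [:0, 1:] * (p\<^sub>0 + p\<^sub>0 + p\<^sub>0 + [:0, 1:] * q + [:20:]) + [:12:]"
  have "runs (subgraph_prog f\<^sub>0 f\<^sub>1) s (poly p (mem s 0)) (\<lambda>s'. out s' =
      subgraph_word (mem s 0) K (\<lambda>i j. mem s (1 + mem s 0 + i * mem s 0 + j) \<noteq> 0))"
    if init: "reg s = (\<lambda>_. 0)" "out s = []"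
      and K0: "\<And>e. sem (mem s) (mem s 0) f\<^sub>0 1 e \<longleftrightarrow> K (e 0)"
      and K1: "\<And>e. sem (mem s) (mem s 0) f\<^sub>1 2 e \<longleftrightarrow> K (e 1)" for s K
  proof -
    define m where "m = mem s"
    define n where "n = mem s 0"
    define w\<^sub>1 where "w\<^sub>1 i = (if K i then [1] else [] :: nat list)" for i
    define w\<^sub>2 where "w\<^sub>2 i j = (if K j then [of_bool (m (1 + n + i * n + j) \<noteq> 0)] else [] :: nat list)" for i j
    define w\<^sub>3 where "w\<^sub>3 i = (if K i then concat (map (w\<^sub>2 i) [0..<n]) else [])" for i
    define ok where "ok s' \<longleftrightarrow> ready 0 s' \<and> mem s' = m \<and> reg s' 0 = n" for s'
    have count: "runs (for_loop 0 (guarded f\<^sub>0 1 (Add 7 7 1))) s' (n * (poly p\<^sub>0 n + 1 + 2 + 3) + 3)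
        (effect 0 s' (concat (map (\<lambda>_. []) [0..<n])) (sum_list (map (\<lambda>i. if K i then 1 else 0) [0..<n])))"
      if s': "ok s'" for s'
    proof -
      have "runs (guarded f\<^sub>0 1 (Add 7 7 1)) r (poly p\<^sub>0 n + 1 + 2)
          (effect (Suc 0) r [] (if K (reg r (8 + 0)) then 1 else 0))"
        if r: "ready (Suc 0) r" "mem r = m" "reg r 0 = n" for r
      proof -
        have "runs (guarded f\<^sub>0 1 (Add 7 7 1)) r (poly p\<^sub>0 n + 1 + 2)
          (effect 1 r (if K (reg r (8 + 0)) then [] else []) (if K (reg r (8 + 0)) then 1 else 0))"
          using p0[of r] r K0 m_def n_def
          by (intro runs_guarded runs_basic) (auto simp: effect_def ready_def)
        then show ?thesis by simp
      qed
      then show ?thesis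
        using runs_for_loop[of 0 s' "guarded f\<^sub>0 1 (Add 7 7 1)" "poly p\<^sub>0 n + 1 + 2" "\<lambda>_. []"] s'
        by (auto simp: ok_def)
    qed
    have vector: "runs (for_loop 0 (guarded f\<^sub>0 1 (Write 1))) s' (n * (poly p\<^sub>0 n + 1 + 2 + 3) + 3)
        (effect 0 s' (concat (map w\<^sub>1 [0..<n])) (sum_list (map (\<lambda>_. 0) [0..<n])))"
      if s': "ok s'" for s'
    proof -
      have "runs (guarded f\<^sub>0 1 (Write 1)) r (poly p\<^sub>0 n + 1 + 2)
          (effect (Suc 0) r (w\<^sub>1 (reg r (8 + 0))) 0)"
        if r: "ready (Suc 0) r" "mem r = m" "reg r 0 = n" for r
      proof -
        have "runs (guarded f\<^sub>0 1 (Write 1)) r (poly p\<^sub>0 n + 1 + 2)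
          (effect 1 r (if K (reg r (8 + 0)) then [1] else []) (if K (reg r (8 + 0)) then 0 else 0))"
          using p0[of r] r K0 m_def n_def
          by (intro runs_guarded runs_basic) (auto simp: effect_def ready_def)
        then show ?thesis by (simp add: w\<^sub>1_def)
      qed
      then show ?thesis
        using runs_for_loop[of 0 s' "guarded f\<^sub>0 1 (Write 1)" "poly p\<^sub>0 n + 1 + 2" w\<^sub>1 "\<lambda>_. 0"] s'
        by (auto simp: ok_def)
    qed
    let ?bit = "Seq (compile (Adj 0 1) 2) (If 2 (Write 1) (Write 2))"
    have bit: "runs ?bit r (poly p\<^sub>2 n + (1 + 1 + 1))
        (effect 2 r [of_bool (m (1 + n + reg r 8 * n + reg r 9) \<noteq> 0)] 0)"
      if r: "ready 2 r" "mem r = m" "reg r 0 = n" for r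
    proof (rule runs_Seq, rule runs_conseq[OF p2[OF r(1)]], simp add: r, rule runs_If, goal_cases)
      case (1 r')
      then show ?case
        using r by (intro runs_basic) (auto simp: decides_def effect_def ready_def)
    next
      case (2 r')
      then show ?case
        using r by (intro runs_basic) (auto simp: decides_def effect_def ready_def)
    qed
    have row: "runs (for_loop 1 (guarded f\<^sub>1 2 ?bit)) s' (n * poly q n + 3)
        (effect 1 s' (concat (map (w\<^sub>2 (reg s' 8)) [0..<n])) (sum_list (map (\<lambda>_. 0) [0..<n])))"
      if s': "ready 1 s'" "mem s' = m" "reg s' 0 = n" for s'
    proof -
      have "runs (guarded f\<^sub>1 2 ?bit) r (poly p\<^sub>1 n + (poly p\<^sub>2 n + (1 + 1 + 1)) + 2)
          (effect (Suc 1) r (w\<^sub>2 (reg s' 8) (reg r (8 + 1))) 0)"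
        if r: "ready (Suc 1) r" "mem r = m" "reg r 0 = n" "\<And>i. i < 1 \<Longrightarrow> reg r (8 + i) = reg s' (8 + i)" for r
      proof -
        have r2: "ready 2 r" "reg r 8 = reg s' 8" using r(1) r(4)[of 0] by (simp_all add: numeral_2_eq_2)
        have "runs (guarded f\<^sub>1 2 ?bit) r (poly p\<^sub>1 n + (poly p\<^sub>2 n + (1 + 1 + 1)) + 2)
          (effect 2 r (if K (reg r (8 + 1)) then [of_bool (m (1 + n + reg r 8 * n + reg r 9) \<noteq> 0)] else [])
            (if K (reg r (8 + 1)) then 0 else 0))"
        proof (rule runs_guarded, goal_cases)
          case 1
          then show ?case using p1[OF r2(1)] r(3) by simp
        next
          case (2 r')
          have "ready 2 r'" "mem r' = m" "reg r' 0 = n" "reg r' 8 = reg r 8" "reg r' 9 = reg r 9"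
            using ready_effect[OF 2] r2 r(2,3) 2 by (auto simp: effect_def)
          then show ?case using bit[of r'] by simp
        next
          case 3
          then show ?case using K1[of "\<lambda>i. reg r (8 + i)"] r by (simp add: m_def n_def)
        qed
        moreover have "w\<^sub>2 (reg s' 8) (reg r (8 + 1)) = (if K (reg r (8 + 1))
            then [of_bool (m (1 + n + reg r 8 * n + reg r 9) \<noteq> 0)] else [])"
          by (simp add: w\<^sub>2_def r2)
        moreover have "Suc 1 = (2 :: nat)" by simp
        ultimately show ?thesis by (simp only: if_cancel)
      qed
      then show ?thesis
        using runs_for_loop[of 1 s' "guarded f\<^sub>1 2 ?bit" "poly p\<^sub>1 n + (poly p\<^sub>2 n + (1 + 1 + 1)) + 2"
            "w\<^sub>2 (reg s' 8)" "\<lambda>_. 0"] s'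
        by (auto simp: q_def algebra_simps)
    qed
    have matrix: "runs (for_loop 0 (guarded f\<^sub>0 1 (for_loop 1 (guarded f\<^sub>1 2 ?bit)))) s'
        (n * (poly p\<^sub>0 n + (n * poly q n + 3) + 2 + 3) + 3)
        (effect 0 s' (concat (map w\<^sub>3 [0..<n])) (sum_list (map (\<lambda>_. 0) [0..<n])))"
      if s': "ok s'" for s'
    proof -
      have "runs (guarded f\<^sub>0 1 (for_loop 1 (guarded f\<^sub>1 2 ?bit))) r
          (poly p\<^sub>0 n + (n * poly q n + 3) + 2) (effect (Suc 0) r (w\<^sub>3 (reg r (8 + 0))) 0)"
        if r: "ready (Suc 0) r" "mem r = m" "reg r 0 = n" for r
      proof -
        have "runs (guarded f\<^sub>0 1 (for_loop 1 (guarded f\<^sub>1 2 ?bit))) r (poly p\<^sub>0 n + (n * poly q n + 3) + 2)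
          (effect 1 r (if K (reg r (8 + 0)) then concat (map (w\<^sub>2 (reg r 8)) [0..<n]) else [])
            (if K (reg r (8 + 0)) then 0 else 0))"
        proof (rule runs_guarded, goal_cases)
          case 1
          then show ?case using p0[of r] r by simp
        next
          case (2 r')
          have "ready 1 r'" "mem r' = m" "reg r' 0 = n" "reg r' 8 = reg r 8"
            using ready_effect[OF 2] r 2 by (auto simp: effect_def)
          then show ?case using row[of r'] by simp
        next
          case 3
          then show ?case using K0[of "\<lambda>i. reg r (8 + i)"] r by (simp add: m_def n_def)
        qed
        then show ?thesis by (simp add: w\<^sub>3_def)
      qed
      then show ?thesis
        using runs_for_loop[of 0 s' "guarded f\<^sub>0 1 (for_loop 1 (guarded f\<^sub>1 2 ?bit))"
            "poly p\<^sub>0 n + (n * poly q n + 3) + 2" w\<^sub>3 "\<lambda>_. 0"] s'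
        by (auto simp: ok_def)
    qed
    let ?T = "n * (poly p\<^sub>0 n + 1 + 2 + 3) + 3"
    let ?U = "n * (poly p\<^sub>0 n + (n * poly q n + 3) + 2 + 3) + 3"
    define c where "c = sum_list (map (\<lambda>i. if K i then 1 else 0 :: nat) [0..<n])"
    have "runs (subgraph_prog f\<^sub>0 f\<^sub>1) s (1 + (1 + (?T + (1 + (?T + ?U)))))
        (\<lambda>s'. out s' = c # concat (map w\<^sub>1 [0..<n]) @ concat (map w\<^sub>3 [0..<n]))"
      unfolding subgraph_prog_def
    proof (rule runs_Seq, rule runs_basic, rule runs_Seq, rule runs_basic, rule runs_Seq,
        rule runs_conseq[OF count order.refl], goal_cases)
      case 1
      then show ?case using init by (simp add: ok_def ready_def m_def n_def)
    next
      case (2 s1)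
      then have s1: "ok s1" "out s1 = []" "reg s1 7 = c"
        using init by (auto simp: ok_def ready_def m_def n_def effect_def c_def)
      show ?case
      proof (rule runs_Seq, rule runs_basic, rule runs_Seq, rule runs_conseq[OF vector order.refl], goal_cases)
        case 1
        then show ?case using s1 by (simp add: ok_def ready_def)
      next
        case (2 s2)
        then have s2: "ok s2" "out s2 = c # concat (map w\<^sub>1 [0..<n])"
          using s1 by (auto simp: ok_def ready_def effect_def)
        show ?case
          by (rule runs_conseq[OF matrix[OF s2(1)] order.refl]) (simp add: effect_def s2)
      qed
    qed
    then show ?thesis
      unfolding subgraph_word_def c_def w\<^sub>1_def[abs_def] w\<^sub>2_def[abs_def] w\<^sub>3_def[abs_def] m_def n_def
      by (rule runs_conseq) (auto simp: p_def algebra_simps)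
  qed
  then show ?thesis by blast
qed

section \<open>The kept vertices\<close>

text \<open>The order of the indices makes choosing three elements first-order definable.\<close>

definition first3 :: "nat \<Rightarrow> (nat \<Rightarrow> bool) \<Rightarrow> nat \<Rightarrow> bool" where
  "first3 n P i \<longleftrightarrow> P i \<and>
     \<not> (\<exists>x<n. \<exists>y<n. \<exists>z<n. x < y \<and> y < z \<and> z < i \<and> P x \<and> P y \<and> P z)"

lemma card_first3_le: "card {i. i < n \<and> first3 n P i} \<le> 3"
proof (rule ccontr)
  let ?R = "{i. i < n \<and> first3 n P i}"
  let ?xs = "sorted_list_of_set ?R"
  assume "\<not> card ?R \<le> 3"
  then have len: "3 < length ?xs" by simp
  have "sorted_wrt (<) ?xs" by (rule strict_sorted_list_of_set)
  with len have "?xs ! 0 < ?xs ! 1" "?xs ! 1 < ?xs ! 2" "?xs ! 2 < ?xs ! 3"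
    by (auto intro: sorted_wrt_nth_less)
  moreover have "?xs ! j \<in> ?R" if "j \<le> 3" for j
    using nth_mem[of j ?xs] that len by simp
  then have "?xs ! 0 \<in> ?R" "?xs ! 1 \<in> ?R" "?xs ! 2 \<in> ?R" "?xs ! 3 \<in> ?R" by auto
  ultimately show False unfolding first3_def mem_Collect_eq by blast
qed

text \<open>If fewer than three indices are selected, then by induction all smaller candidates are
  selected, so three of them cannot block \<open>i\<close>. The dichotomy mirrors the two
  alternatives of \<open>represents\<close>.\<close>

lemma first3_all_or_three:
  "{i. i < n \<and> first3 n P i} = {i. i < n \<and> P i} \<or> 3 \<le> card {i. i < n \<and> first3 n P i}"
proof (rule disjCI)
  assume "\<not> 3 \<le> card {i. i < n \<and> first3 n P i}"
  have "first3 n P i" if "i < n" "P i" for i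
    using that
  proof (induction i rule: less_induct)
    case (less i)
    show ?case
    proof (rule ccontr)
      assume "\<not> first3 n P i"
      then obtain x y z where xyz: "x < y" "y < z" "z < i" "P x" "P y" "P z"
        using less.prems by (auto simp: first3_def)
      then have "{x, y, z} \<subseteq> {i. i < n \<and> first3 n P i}"
        using less by auto
      then have "card {x, y, z} \<le> card {i. i < n \<and> first3 n P i}"
        by (intro card_mono) auto
      with xyz \<open>\<not> 3 \<le> _\<close> show False by simp
    qed
  qed
  moreover have "first3 n P i \<Longrightarrow> P i" for i
    by (simp add: first3_def)
  ultimately show "{i. i < n \<and> first3 n P i} = {i. i < n \<and> P i}"
    by blast
qed

text \<open>When non-adjacency is an equivalence on \<open>N\<close>, this is the least index of
  each class.\<close>

definition part_first :: "nat \<Rightarrow> (nat \<Rightarrow> nat \<Rightarrow> bool) \<Rightarrow> (nat \<Rightarrow> bool) \<Rightarrow> nat \<Rightarrow> bool" where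
  "part_first n a N i \<longleftrightarrow> N i \<and> \<not> (\<exists>w<n. w < i \<and> N w \<and> \<not> a w i)"

text \<open>The first vertices of distinct parts are pairwise adjacent. Thus either all of them are
  selected and every part is hit, or three of them form the required triangle.\<close>

lemma represents_part_firsts:
  assumes vs: "N \<subseteq> set vs" and sym: "\<And>u v. (u, v) \<in> E \<Longrightarrow> (v, u) \<in> E" and irrefl: "\<And>v. (v, v) \<notin> E"
    and trans: "\<And>u v w. \<lbrakk>u \<in> N; v \<in> N; w \<in> N; (u, v) \<notin> E; (v, w) \<notin> E\<rbrakk> \<Longrightarrow> (u, w) \<notin> E"
  shows "represents E ((!) vs ` {i. i < length vs \<and> first3 (length vs)
    (part_first (length vs) (\<lambda>i j. (vs ! i, vs ! j) \<in> E) (\<lambda>i. vs ! i \<in> N)) i}) N"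
proof -
  let ?n = "length vs"
  let ?F = "part_first ?n (\<lambda>i j. (vs ! i, vs ! j) \<in> E) (\<lambda>i. vs ! i \<in> N)"
  let ?R = "{i. i < ?n \<and> first3 ?n ?F i}"
  from first3_all_or_three[of ?n ?F] show ?thesis
  proof
    assume R: "?R = {i. i < ?n \<and> ?F i}"
    have "\<exists>w\<in>((!) vs ` ?R) \<inter> N. (v, w) \<notin> E" if v: "v \<in> N" for v
    proof -
      let ?Q = "\<lambda>i. i < ?n \<and> vs ! i \<in> N \<and> (v, vs ! i) \<notin> E"
      define i where "i = (LEAST i. ?Q i)"
      have "\<exists>i. ?Q i" using v vs irrefl by (metis in_set_conv_nth subsetD)
      then have i: "?Q i" unfolding i_def by (rule LeastI_ex)
      \<comment> \<open>An earlier non-neighbour of \<open>vs ! i\<close> in \<open>N\<close> would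
        by transitivity be a non-neighbour of \<open>v\<close>, against the minimality of
        \<open>i\<close>.\<close>
      have "?F i"
        unfolding part_first_def
      proof (intro conjI notI)
        assume "\<exists>w<?n. w < i \<and> vs ! w \<in> N \<and> (vs ! w, vs ! i) \<notin> E"
        then obtain w where w: "w < ?n" "w < i" "vs ! w \<in> N" "(vs ! w, vs ! i) \<notin> E" by blast
        then have "(v, vs ! w) \<notin> E" using trans[of v "vs ! i" "vs ! w"] v i sym by blast
        with w not_less_Least[of w ?Q] show False by (auto simp: i_def)
      qed (use i in blast)
      with i R show ?thesis by blast
    qed
    then show ?thesis unfolding represents_def by blast
  next
    assume "3 \<le> card ?R"
    then obtain T where "T \<subseteq> ?R" "card T = 3" by (rule obtain_subset_with_card_n)
    then obtain x y z where xyz: "x \<in> ?R" "y \<in> ?R" "z \<in> ?R" "x \<noteq> y" "x \<noteq> z" "y \<noteq> z"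
      by (auto simp: card_3_iff)
    have adj: "(vs ! i, vs ! j) \<in> E" if ij: "i \<in> ?R" "j \<in> ?R" "i \<noteq> j" for i j
    proof -
      have *: "(vs ! i, vs ! j) \<in> E" if "i \<in> ?R" "j \<in> ?R" "i < j" for i j
        using that unfolding first3_def part_first_def by blast
      show ?thesis using *[of i j] *[of j i] ij sym by (cases i j rule: linorder_cases) auto
    qed
    have "vs ! i \<in> ((!) vs ` ?R) \<inter> N" if "i \<in> ?R" for i
      using that by (auto simp: first3_def part_first_def)
    then show ?thesis using xyz adj unfolding represents_def by meson
  qed
qed

text \<open>The second and third disjuncts serve \<open>separation_star\<close>, by securing enough
  vertices and, if one exists, a vertex with a stable neighbourhood. The last two provide the
  representatives for \<open>rep_all\<close> and \<open>rep_triple\<close>.\<close>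

definition keep :: "nat \<Rightarrow> (nat \<Rightarrow> nat \<Rightarrow> bool) \<Rightarrow> (nat \<Rightarrow> bool) \<Rightarrow> nat \<Rightarrow> bool" where
  "keep n a inX i \<longleftrightarrow> inX i \<or> first3 n (\<lambda>_. True) i \<or>
     first3 n (\<lambda>v. \<not> (\<exists>u<n. \<exists>w<n. a v u \<and> a v w \<and> a u w)) i \<or>
     first3 n (part_first n a (\<lambda>v. \<not> inX v)) i \<or>
     (\<exists>x<n. \<exists>y<n. \<exists>z<n. inX x \<and> inX y \<and> inX z \<and>
       first3 n (part_first n a (\<lambda>v. \<not> inX v \<and> a x v \<and> a y v \<and> a z v)) i)"

lemma first3_cong:
  assumes "\<And>i. i < n \<Longrightarrow> P i \<longleftrightarrow> Q i" "i < n"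
  shows "first3 n P i \<longleftrightarrow> first3 n Q i"
  using assms unfolding first3_def by (simp cong: conj_cong)

lemma part_first_cong:
  assumes "\<And>i j. i < n \<Longrightarrow> j < n \<Longrightarrow> a i j \<longleftrightarrow> b i j" "\<And>i. i < n \<Longrightarrow> P i \<longleftrightarrow> Q i" "i < n"
  shows "part_first n a P i \<longleftrightarrow> part_first n b Q i"
  using assms unfolding part_first_def by (simp cong: conj_cong)

text \<open>Memory and graph are only known to agree on indices below \<open>n\<close>, so the
  predicates cannot simply be replaced by equal ones.\<close>

lemma keep_cong:
  assumes ab: "\<And>i j. i < n \<Longrightarrow> j < n \<Longrightarrow> a i j \<longleftrightarrow> b i j"
    and fg: "\<And>i. i < n \<Longrightarrow> f i \<longleftrightarrow> g i" and i: "i < n"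
  shows "keep n a f i \<longleftrightarrow> keep n b g i"
proof -
  have "first3 n (\<lambda>v. \<not> (\<exists>u<n. \<exists>w<n. a v u \<and> a v w \<and> a u w)) i \<longleftrightarrow>
      first3 n (\<lambda>v. \<not> (\<exists>u<n. \<exists>w<n. b v u \<and> b v w \<and> b u w)) i"
    using ab i by (intro first3_cong) (simp_all cong: conj_cong)
  moreover have "first3 n (part_first n a (\<lambda>v. \<not> f v)) i \<longleftrightarrow>
      first3 n (part_first n b (\<lambda>v. \<not> g v)) i"
    using ab fg i by (intro first3_cong part_first_cong) simp_all
  moreover have "first3 n (part_first n a (\<lambda>v. \<not> f v \<and> a x v \<and> a y v \<and> a z v)) i \<longleftrightarrow>
      first3 n (part_first n b (\<lambda>v. \<not> g v \<and> b x v \<and> b y v \<and> b z v)) i"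
    if "x < n" "y < n" "z < n" for x y z
    using ab fg i that by (intro first3_cong part_first_cong) simp_all
  ultimately show ?thesis
    unfolding keep_def using fg i by (simp cong: conj_cong)
qed

section \<open>The kept vertices as a first-order formula\<close>

text \<open>\<open>F\<close> takes the depth as well as the variable, since its copies stand at
  depths \<open>d\<close> and \<open>d + 3\<close> and bind different levels there.\<close>

definition first3_fm :: "(nat \<Rightarrow> nat \<Rightarrow> fm) \<Rightarrow> nat \<Rightarrow> nat \<Rightarrow> fm" where
  "first3_fm F d i = Conj (F d i) (Neg (Ex (Ex (Ex (Conj (Less d (d + 1))
     (Conj (Less (d + 1) (d + 2)) (Conj (Less (d + 2) i)
     (Conj (F (d + 3) d) (Conj (F (d + 3) (d + 1)) (F (d + 3) (d + 2)))))))))))"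

text \<open>\<open>N\<close> takes only the variable: the formulas supplied for it are
  quantifier-free and read the same at both depths.\<close>

definition part_first_fm :: "(nat \<Rightarrow> fm) \<Rightarrow> nat \<Rightarrow> nat \<Rightarrow> fm" where
  "part_first_fm N d i = Conj (N i) (Neg (Ex (Conj (Less d i) (Conj (N d) (Neg (Adj d i))))))"

definition disj_fm :: "fm \<Rightarrow> fm \<Rightarrow> fm" where
  "disj_fm f g = Neg (Conj (Neg f) (Neg g))"

text \<open>\<open>Neg (Less v v)\<close> serves as truth.\<close>

definition keep_fm :: "nat \<Rightarrow> nat \<Rightarrow> fm" where
  "keep_fm d i = disj_fm (InX i) (disj_fm (first3_fm (\<lambda>_ v. Neg (Less v v)) d i)
     (disj_fm (first3_fm (\<lambda>d v. Neg (Ex (Ex (Conj (Adj v d) (Conj (Adj v (d + 1)) (Adj d (d + 1))))))) d i)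
     (disj_fm (first3_fm (part_first_fm (\<lambda>v. Neg (InX v))) d i)
     (Ex (Ex (Ex (Conj (InX d) (Conj (InX (d + 1)) (Conj (InX (d + 2))
       (first3_fm (part_first_fm (\<lambda>v. Conj (Neg (InX v))
         (Conj (Adj d v) (Conj (Adj (d + 1) v) (Adj (d + 2) v))))) (d + 3) i))))))))))"

lemma wf_keep_fm: "i < d \<Longrightarrow> wf_fm (keep_fm d i) d"
  unfolding keep_fm_def disj_fm_def first3_fm_def part_first_fm_def by simp

lemma sem_part_first_fm:
  assumes "i < d"
    and "\<And>e' j. \<lbrakk>j < Suc d; \<And>l. l < d \<Longrightarrow> e' l = e l\<rbrakk> \<Longrightarrow> sem m n (N j) (Suc d) e' \<longleftrightarrow> P (e' j)"
    and "sem m n (N i) d e \<longleftrightarrow> P (e i)"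
  shows "sem m n (part_first_fm N d i) d e \<longleftrightarrow>
    part_first n (\<lambda>i j. m (1 + n + i * n + j) \<noteq> 0) P (e i)"
  using assms unfolding part_first_fm_def part_first_def by simp

lemma sem_first3_fm:
  assumes "i < d"
    and "\<And>e' d' j. \<lbrakk>d \<le> d'; j < d'; \<And>l. l < d \<Longrightarrow> e' l = e l\<rbrakk> \<Longrightarrow> sem m n (F d' j) d' e' \<longleftrightarrow> P (e' j)"
  shows "sem m n (first3_fm F d i) d e \<longleftrightarrow> first3 n P (e i)"
  using assms unfolding first3_fm_def first3_def by (simp add: numeral_3_eq_3)

lemma sem_keep_fm:
  assumes i: "i < d"
  shows "sem m n (keep_fm d i) d e \<longleftrightarrow>
     keep n (\<lambda>i j. m (1 + n + i * n + j) \<noteq> 0) (\<lambda>i. m (1 + i) \<noteq> 0) (e i)"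
proof -
  let ?a = "\<lambda>i j. m (1 + n + i * n + j) \<noteq> 0"
  have "sem m n (first3_fm (\<lambda>_ v. Neg (Less v v)) d i) d e \<longleftrightarrow> first3 n (\<lambda>_. True) (e i)"
    using i by (intro sem_first3_fm) simp_all
  moreover have "sem m n (first3_fm (\<lambda>d v. Neg (Ex (Ex
        (Conj (Adj v d) (Conj (Adj v (d + 1)) (Adj d (d + 1))))))) d i) d e \<longleftrightarrow>
      first3 n (\<lambda>v. \<not> (\<exists>u<n. \<exists>w<n. ?a v u \<and> ?a v w \<and> ?a u w)) (e i)"
    using i by (intro sem_first3_fm) simp_all
  moreover have "sem m n (first3_fm (part_first_fm (\<lambda>v. Neg (InX v))) d i) d e \<longleftrightarrow>
      first3 n (part_first n ?a (\<lambda>v. \<not> m (1 + v) \<noteq> 0)) (e i)"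
    using i by (intro sem_first3_fm sem_part_first_fm) simp_all
  moreover have "sem m n (first3_fm (part_first_fm (\<lambda>v. Conj (Neg (InX v))
        (Conj (Adj d v) (Conj (Adj (d + 1) v) (Adj (d + 2) v))))) (d + 3) i) (d + 3) e' \<longleftrightarrow>
      first3 n (part_first n ?a (\<lambda>v. \<not> m (1 + v) \<noteq> 0 \<and> ?a (e' d) v \<and> ?a (e' (d + 1)) v \<and>
        ?a (e' (d + 2)) v)) (e' i)" for e'
    using i by (intro sem_first3_fm sem_part_first_fm) simp_all
  ultimately show ?thesis
    unfolding keep_fm_def keep_def disj_fm_def using i by (simp add: numeral_3_eq_3)
qed

section \<open>Reading the encoding, and properties of the kept set\<close>

lemma concat_nth_uniform:
  "\<lbrakk>\<forall>ys\<in>set xss. length ys = n; i < length xss; j < n\<rbrakk> \<Longrightarrow> concat xss ! (i * n + j) = xss ! i ! j"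
proof (induction xss arbitrary: i)
  case (Cons ys xss)
  then show ?case by (cases i) (auto simp: nth_append)
qed simp

lemma length_concat_uniform:
  "\<forall>ys\<in>set xss. length ys = n \<Longrightarrow> length (concat xss) = length xss * n"
  by (induction xss) auto

lemma concat_map_filter_if:
  "concat (map (\<lambda>i. if P i then f i else []) xs) = concat (map f (filter P xs))"
  by (induction xs) auto

lemma sum_list_filter_if: "sum_list (map (\<lambda>i. if P i then 1 else 0) xs) = length (filter P xs)"
  by (induction xs) auto

lemma poly_nat_mono: "(m :: nat) \<le> n \<Longrightarrow> poly p m \<le> poly p n"
  by (induction p) (auto intro!: add_mono mult_mono)

lemma mem_encode:
  assumes "n = length vs"
  shows "mem (input_state (encode vs G X)) 0 = n"
    and "i < n \<Longrightarrow> mem (input_state (encode vs G X)) (1 + i) = of_bool (vs ! i \<in> X)"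
    and "i < n \<Longrightarrow> j < n \<Longrightarrow>
      mem (input_state (encode vs G X)) (1 + n + i * n + j) = of_bool ((vs ! i, vs ! j) \<in> parcs G)"
proof -
  let ?M = "map (\<lambda>u. map (\<lambda>v. of_bool ((u, v) \<in> parcs G)) vs) vs :: nat list list"
  have len: "length (concat ?M) = n * n"
    using length_concat_uniform[of ?M n] assms by auto
  show "mem (input_state (encode vs G X)) 0 = n"
    by (simp add: input_state_def encode_def assms)
  show "mem (input_state (encode vs G X)) (1 + i) = of_bool (vs ! i \<in> X)" if "i < n"
    using that assms by (simp add: input_state_def encode_def nth_append)
  show "mem (input_state (encode vs G X)) (1 + n + i * n + j) = of_bool ((vs ! i, vs ! j) \<in> parcs G)"
    if ij: "i < n" "j < n"
  proof -
    have "(i + 1) * n \<le> n * n" using ij by (intro mult_right_mono) auto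
    then have "i * n + j < n * n" using ij by simp
    moreover have "concat ?M ! (i * n + j) = of_bool ((vs ! i, vs ! j) \<in> parcs G)"
      using concat_nth_uniform[of ?M n i j] ij assms by simp
    ultimately show ?thesis
      using len assms by (simp add: input_state_def encode_def nth_append)
  qed
qed

definition kept :: "'a list \<Rightarrow> 'a pair_pre_digraph \<Rightarrow> 'a set \<Rightarrow> 'a set" where
  "kept vs G X = (!) vs ` {i. i < length vs \<and>
     keep (length vs) (\<lambda>i j. (vs ! i, vs ! j) \<in> parcs G) (\<lambda>i. vs ! i \<in> X) i}"

lemma card_picks_le: "card ((!) vs ` {i. i < length vs \<and> first3 (length vs) P i}) \<le> 3"
  using card_image_le[of "{i. i < length vs \<and> first3 (length vs) P i}" "(!) vs"]
    card_first3_le[of "length vs" P] by simp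

text \<open>Three selections of at most three vertices give 9, and each ordered triple from
  \<open>X\<close> adds at most three more.\<close>

lemma card_kept_le:
  assumes vs: "distinct vs" and X: "X \<subseteq> set vs"
  shows "card (kept vs G X) \<le> card X + 9 + 3 * card X ^ 3"
proof -
  let ?n = "length vs"
  let ?a = "\<lambda>i j. (vs ! i, vs ! j) \<in> parcs G"
  let ?p = "\<lambda>P. (!) vs ` {i. i < ?n \<and> first3 ?n P i}"
  define I where "I = {i. i < ?n \<and> vs ! i \<in> X}"
  define R where "R x y z = ?p (part_first ?n ?a (\<lambda>v. \<not> vs ! v \<in> X \<and> ?a x v \<and> ?a y v \<and> ?a z v))"
    for x y z
  let ?U = "\<Union>(x, y, z)\<in>I \<times> I \<times> I. R x y z"
  let ?A = "?p (\<lambda>_. True)"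
  let ?B = "?p (\<lambda>v. \<not> (\<exists>u<?n. \<exists>w<?n. ?a v u \<and> ?a v w \<and> ?a u w))"
  let ?C = "?p (part_first ?n ?a (\<lambda>v. \<not> vs ! v \<in> X))"
  have img: "(!) vs ` I = X" using X by (force simp: I_def in_set_conv_nth)
  have "inj_on ((!) vs) I" using vs by (auto simp: I_def inj_on_def nth_eq_iff_index_eq)
  with img have cI: "card I = card X" using card_image by metis
  have fin: "finite I" "finite X" using X finite_subset by (auto simp: I_def)
  have "card ?U \<le> (\<Sum>(x, y, z)\<in>I \<times> I \<times> I. card (R x y z))"
    using card_UN_le[of "I \<times> I \<times> I" "\<lambda>(x, y, z). R x y z"] fin by (simp add: case_prod_unfold)
  also have "\<dots> \<le> (\<Sum>(x, y, z)\<in>I \<times> I \<times> I. 3)"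
    using card_picks_le by (intro sum_mono) (auto simp: R_def)
  also have "\<dots> = 3 * card X ^ 3"
    by (simp add: case_prod_unfold card_cartesian_product cI power3_eq_cube)
  finally have U: "card ?U \<le> 3 * card X ^ 3" .
  have "kept vs G X \<subseteq> X \<union> (?A \<union> (?B \<union> (?C \<union> ?U)))"
  proof
    fix v assume "v \<in> kept vs G X"
    then obtain i where i: "i < ?n" "v = vs ! i" "keep ?n ?a (\<lambda>i. vs ! i \<in> X) i"
      by (auto simp: kept_def)
    have "v \<in> ?U" if "x < ?n" "y < ?n" "z < ?n" "vs ! x \<in> X" "vs ! y \<in> X" "vs ! z \<in> X"
      "first3 ?n (part_first ?n ?a (\<lambda>v. \<not> vs ! v \<in> X \<and> ?a x v \<and> ?a y v \<and> ?a z v)) i" for x y z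
      using that i(1,2) by (intro UN_I[of "(x, y, z)"]) (simp_all add: R_def I_def)
    with i show "v \<in> X \<union> (?A \<union> (?B \<union> (?C \<union> ?U)))"
      unfolding keep_def by blast
  qed
  then have "card (kept vs G X) \<le> card (X \<union> (?A \<union> (?B \<union> (?C \<union> ?U))))"
    using fin by (intro card_mono) (auto simp: R_def)
  also have "\<dots> \<le> card X + (card ?A + (card ?B + (card ?C + card ?U)))"
    by (meson add_left_mono card_Un_le order_trans)
  also have "\<dots> \<le> card X + (3 + (3 + (3 + 3 * card X ^ 3)))"
    using U by (intro add_mono card_picks_le order.refl)
  finally show ?thesis by simp
qed

lemma picks_subset_kept:
  assumes "\<And>i. i < length vs \<Longrightarrow> first3 (length vs) P i \<Longrightarrow>
    keep (length vs) (\<lambda>i j. (vs ! i, vs ! j) \<in> parcs G) (\<lambda>i. vs ! i \<in> X) i"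
  shows "(!) vs ` {i. i < length vs \<and> first3 (length vs) P i} \<subseteq> kept vs G X"
  using assms unfolding kept_def by blast

text \<open>Each selection is an instance of \<open>represents_part_firsts\<close>, and
  representation survives enlarging the selection to all kept vertices.\<close>

lemma co_cluster_kernel_kept:
  assumes inst: "mod_co_cluster_instance G X" and vs: "enumerates vs G"
  shows "co_cluster_kernel (pverts G) (parcs G) X (kept vs G X)"
proof -
  interpret G: pair_graph G using inst by (simp add: mod_co_cluster_instance_def)
  let ?n = "length vs"
  let ?a = "\<lambda>i j. (vs ! i, vs ! j) \<in> parcs G"
  let ?H = "pverts G - X"
  have set_vs: "set vs = pverts G" and XV: "X \<subseteq> pverts G"
    using inst vs by (auto simp: mod_co_cluster_instance_def enumerates_def)
  have sym: "(u, v) \<in> parcs G \<Longrightarrow> (v, u) \<in> parcs G" for u v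
    using G.pair_sym_arcs by (auto simp: symmetric_def dest: symD)
  have irrefl: "(v, v) \<notin> parcs G" for v
    using G.pair_no_loops by fastforce
  have trans: "(u, w) \<notin> parcs G"
    if "u \<in> ?H" "v \<in> ?H" "w \<in> ?H" "(u, v) \<notin> parcs G" "(v, w) \<notin> parcs G" for u v w
    using co_cluster_nonadjacent_trans[of G X u v w] inst that irrefl
    by (cases "u = w") (auto simp: mod_co_cluster_instance_def)
  have rep: "represents (parcs G) ((!) vs ` {i. i < ?n \<and>
      first3 ?n (part_first ?n ?a (\<lambda>i. vs ! i \<in> N)) i}) N" if "N \<subseteq> ?H" for N
    using that set_vs sym irrefl trans by (intro represents_part_firsts) blast+
  show ?thesis
  proof
    show "X \<subseteq> kept vs G X"
    proof
      fix v assume "v \<in> X"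
      moreover from this obtain i where "i < ?n" "v = vs ! i"
        using XV set_vs by (metis in_set_conv_nth subsetD)
      ultimately show "v \<in> kept vs G X" unfolding kept_def keep_def by blast
    qed
    show "kept vs G X \<subseteq> pverts G"
      using set_vs nth_mem[of _ vs] unfolding kept_def by blast
    show "represents (parcs G) (kept vs G X) ?H"
    proof (rule represents_mono[OF rep picks_subset_kept])
      fix i assume i: "i < ?n" "first3 ?n (part_first ?n ?a (\<lambda>i. vs ! i \<in> ?H)) i"
      have "first3 ?n (part_first ?n ?a (\<lambda>i. vs ! i \<in> ?H)) i \<longleftrightarrow>
          first3 ?n (part_first ?n ?a (\<lambda>i. \<not> vs ! i \<in> X)) i"
        using i(1) set_vs nth_mem[of _ vs] by (intro first3_cong part_first_cong) auto
      with i show "keep ?n ?a (\<lambda>i. vs ! i \<in> X) i" by (simp add: keep_def)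
    qed simp
    fix x y z assume xyz: "x \<in> X" "y \<in> X" "z \<in> X"
    then obtain j k l where jkl: "j < ?n" "k < ?n" "l < ?n" "x = vs ! j" "y = vs ! k" "z = vs ! l"
      using XV set_vs by (metis in_set_conv_nth subsetD)
    let ?N = "{v \<in> ?H. (x, v) \<in> parcs G \<and> (y, v) \<in> parcs G \<and> (z, v) \<in> parcs G}"
    show "represents (parcs G) (kept vs G X) ?N"
    proof (rule represents_mono[OF rep picks_subset_kept])
      fix i assume i: "i < ?n" "first3 ?n (part_first ?n ?a (\<lambda>i. vs ! i \<in> ?N)) i"
      have "first3 ?n (part_first ?n ?a (\<lambda>i. vs ! i \<in> ?N)) i \<longleftrightarrow>
          first3 ?n (part_first ?n ?a (\<lambda>i. \<not> vs ! i \<in> X \<and> ?a j i \<and> ?a k i \<and> ?a l i)) i"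
        using i(1) set_vs nth_mem[of _ vs] jkl by (intro first3_cong part_first_cong) auto
      with i jkl xyz show "keep ?n ?a (\<lambda>i. vs ! i \<in> X) i" unfolding keep_def by blast
    qed blast
  qed (use sym irrefl trans in blast)+
qed

lemma stable_neighbourhood_kept:
  assumes vs: "enumerates vs G" and G: "pair_graph G"
    and v: "v \<in> pverts G" "\<forall>u w. (v, u) \<in> parcs G \<longrightarrow> (v, w) \<in> parcs G \<longrightarrow> (u, w) \<notin> parcs G"
  shows "\<exists>v\<in>kept vs G X. \<forall>u w. (v, u) \<in> parcs G \<longrightarrow> (v, w) \<in> parcs G \<longrightarrow> (u, w) \<notin> parcs G"
proof -
  interpret G: pair_graph G by fact
  let ?n = "length vs"
  let ?a = "\<lambda>i j. (vs ! i, vs ! j) \<in> parcs G"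
  let ?P = "\<lambda>v. \<not> (\<exists>u<?n. \<exists>w<?n. ?a v u \<and> ?a v w \<and> ?a u w)"
  have set_vs: "set vs = pverts G" using vs by (simp add: enumerates_def)
  obtain j where "j < ?n" "vs ! j = v" using v set_vs by (metis in_set_conv_nth)
  then have "{i. i < ?n \<and> ?P i} \<noteq> {}" using v(2) by blast
  \<comment> \<open>The selection contains all candidates or at least three indices, so it is
    nonempty in either case.\<close>
  then have "{i. i < ?n \<and> first3 ?n ?P i} \<noteq> {}"
    using first3_all_or_three[of ?n ?P] by (metis card.empty not_numeral_le_zero)
  then obtain i where i: "i < ?n" "first3 ?n ?P i" by blast
  have "(u, w) \<notin> parcs G" if uw: "(vs ! i, u) \<in> parcs G" "(vs ! i, w) \<in> parcs G" for u w
  proof -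
    obtain k l where "k < ?n" "u = vs ! k" "l < ?n" "w = vs ! l"
      using uw G.in_arcsD2 set_vs by (metis in_set_conv_nth)
    with uw i show ?thesis unfolding first3_def by blast
  qed
  moreover have "vs ! i \<in> kept vs G X" using i by (auto simp: kept_def keep_def)
  ultimately show ?thesis by blast
qed

lemma kept_all_or_three:
  assumes vs: "enumerates vs G"
  shows "kept vs G X = pverts G \<or> 3 \<le> card (kept vs G X)"
proof -
  let ?n = "length vs"
  let ?R = "{i. i < ?n \<and> first3 ?n (\<lambda>_. True) i}"
  have R: "(!) vs ` ?R \<subseteq> kept vs G X" by (rule picks_subset_kept) (simp add: keep_def)
  have V: "(!) vs ` {i. i < ?n} = pverts G"
    using vs unfolding enumerates_def by (metis set_conv_nth setcompr_eq_image)
  then have KV: "kept vs G X \<subseteq> pverts G" unfolding kept_def by blast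
  from first3_all_or_three[of ?n "\<lambda>_. True"] show ?thesis
  proof
    assume "?R = {i. i < ?n \<and> True}"
    with R V KV show ?thesis by simp
  next
    assume "3 \<le> card ?R"
    moreover have "inj_on ((!) vs) ?R"
      using vs by (auto simp: inj_on_def nth_eq_iff_index_eq enumerates_def)
    ultimately have "3 \<le> card ((!) vs ` ?R)" by (simp add: card_image)
    also have "\<dots> \<le> card (kept vs G X)" using R by (intro card_mono) (simp_all add: kept_def)
    finally show ?thesis by blast
  qed
qed

section \<open>The induced subgraph as output instance and its computation\<close>

definition induced :: "'a pair_pre_digraph \<Rightarrow> 'a set \<Rightarrow> 'a pair_pre_digraph" where
  "induced G K = \<lparr>pverts = K, parcs = {(u, v) \<in> parcs G. u \<in> K \<and> v \<in> K}\<rparr>"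

lemma pair_graph_induced:
  assumes "pair_graph G" "K \<subseteq> pverts G"
  shows "pair_graph (induced G K)"
proof -
  interpret G: pair_graph G by fact
  have "finite K" using assms(2) G.pair_finite_verts finite_subset by blast
  moreover have "finite {(u, v) \<in> parcs G. u \<in> K \<and> v \<in> K}"
    using G.pair_finite_arcs by (rule rev_finite_subset) auto
  ultimately show ?thesis
    using G.pair_sym_arcs G.pair_no_loops
    by unfold_locales (auto simp: induced_def symmetric_def sym_def)
qed

text \<open>This permits the whole kept set as new modulator; the size bound refers to the old
  one.\<close>

lemma co_cluster_del_all_verts: "co_cluster_graph (del_verts G (pverts G))"
  unfolding co_cluster_graph_def cluster_graph_def
  by (intro exI[of _ "{}"]) (auto simp: complement_def del_verts_def partition_on_def)

lemma separation_restrict_arcs: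
  "separation V {(u, v) \<in> E. u \<in> V \<and> v \<in> V} A B \<longleftrightarrow> separation V E A B"
  unfolding separation_def by blast

lemma has_stable_cutset_induced_kept:
  assumes inst: "mod_co_cluster_instance G X" and vs: "enumerates vs G"
  shows "has_stable_cutset (induced G (kept vs G X)) \<longleftrightarrow> has_stable_cutset G"
proof -
  interpret co_cluster_kernel "pverts G" "parcs G" X "kept vs G X"
    by (rule co_cluster_kernel_kept) fact+
  have G: "pair_graph G" using inst by (simp add: mod_co_cluster_instance_def)
  then interpret G: pair_graph G .
  have arcs: "parcs G \<subseteq> pverts G \<times> pverts G" using G.in_arcsD1 G.in_arcsD2 by auto
  have "separation (kept vs G X) (parcs (induced G (kept vs G X))) A B \<longleftrightarrow>
      separation (kept vs G X) (parcs G) A B" for A B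
    by (simp add: induced_def separation_restrict_arcs)
  moreover have "pverts (induced G (kept vs G X)) = kept vs G X" by (simp add: induced_def)
  moreover have "\<exists>A B. separation (kept vs G X) (parcs G) A B" if "separation (pverts G) (parcs G) A B" for A B
    using that G.pair_finite_verts _ arcs kept_all_or_three[OF vs]
    by (rule separation_restrict) (use stable_neighbourhood_kept[OF vs G] in blast)
  ultimately show ?thesis
    unfolding has_stable_cutset_iff_separation[OF G]
      has_stable_cutset_iff_separation[OF pair_graph_induced[OF G KV]]
    using separation_extend by metis
qed

text \<open>The kept vertices are listed in their original order, in which the loops of the program
  emit them.\<close>

lemma encode_induced_kept:
  fixes G :: "'a pair_pre_digraph" and X :: "'a set"
  assumes "enumerates vs G"
  defines "n \<equiv> length vs"
  defines "k \<equiv> keep n (\<lambda>i j. (vs ! i, vs ! j) \<in> parcs G) (\<lambda>i. vs ! i \<in> X)"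
  defines "vs' \<equiv> map ((!) vs) (filter k [0..<n])"
  shows "enumerates vs' (induced G (kept vs G X))"
    and "encode vs' (induced G (kept vs G X)) (kept vs G X) =
      subgraph_word n k (\<lambda>i j. (vs ! i, vs ! j) \<in> parcs G)"
proof -
  have set_vs': "set vs' = kept vs G X"
    by (auto simp: vs'_def k_def n_def kept_def)
  have "distinct vs'"
    using assms(1) by (auto simp: vs'_def distinct_map inj_on_def enumerates_def n_def nth_eq_iff_index_eq)
  then show "enumerates vs' (induced G (kept vs G X))"
    using set_vs' by (simp add: enumerates_def induced_def)
  have row: "map (\<lambda>v. of_bool ((u, v) \<in> parcs (induced G (kept vs G X)))) vs' =
      map (\<lambda>j. of_bool ((u, vs ! j) \<in> parcs G)) (filter k [0..<n])" if "u \<in> set vs'" for u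
    using that set_vs' unfolding vs'_def by (auto simp: induced_def)
  have "map (\<lambda>u. map (\<lambda>v. of_bool ((u, v) \<in> parcs (induced G (kept vs G X)))) vs') vs' =
      map (\<lambda>u. map (\<lambda>j. of_bool ((u, vs ! j) \<in> parcs G)) (filter k [0..<n])) vs'"
    using row by (intro map_cong refl)
  also have "\<dots> = map (\<lambda>i. map (\<lambda>j. of_bool ((vs ! i, vs ! j) \<in> parcs G)) (filter k [0..<n]))
      (filter k [0..<n])"
    by (simp add: vs'_def)
  finally have rows: "map (\<lambda>u. map (\<lambda>v. of_bool ((u, v) \<in> parcs (induced G (kept vs G X)))) vs') vs' =
    (\<dots> :: nat list list)" .
  have ones: "map (\<lambda>v. of_bool (v \<in> kept vs G X)) vs' = map (\<lambda>_. 1 :: nat) (filter k [0..<n])"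
    using set_vs' unfolding vs'_def by auto
  show "encode vs' (induced G (kept vs G X)) (kept vs G X) =
      subgraph_word n k (\<lambda>i j. (vs ! i, vs ! j) \<in> parcs G)"
    unfolding encode_def rows ones subgraph_word_def concat_map_filter_if sum_list_filter_if
    by (simp add: vs'_def concat_map_singleton)
qed

lemma subgraph_word_cong:
  assumes "\<And>i. i < n \<Longrightarrow> K i \<longleftrightarrow> K' i" "\<And>i j. i < n \<Longrightarrow> j < n \<Longrightarrow> a i j \<longleftrightarrow> a' i j"
  shows "subgraph_word n K a = subgraph_word n K' a'"
proof -
  have "map (\<lambda>i. if K i then 1 else 0 :: nat) [0..<n] = map (\<lambda>i. if K' i then 1 else 0) [0..<n]"
    "map (\<lambda>i. if K i then [1 :: nat] else []) [0..<n] = map (\<lambda>i. if K' i then [1] else []) [0..<n]"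
    using assms(1) by simp_all
  moreover have "map (\<lambda>j. if K j then [of_bool (a i j)] else [] :: nat list) [0..<n] =
      map (\<lambda>j. if K' j then [of_bool (a' i j)] else []) [0..<n]" if "i < n" for i
    using assms that by simp
  then have "(if K i then concat (map (\<lambda>j. if K j then [of_bool (a i j)] else []) [0..<n]) else []) =
      (if K' i then concat (map (\<lambda>j. if K' j then [of_bool (a' i j)] else [] :: nat list) [0..<n]) else [])"
    if "i < n" for i
    using assms(1) that by (simp only:)
  then have "map (\<lambda>i. if K i then concat (map (\<lambda>j. if K j then [of_bool (a i j)] else []) [0..<n])
      else []) [0..<n] =
      (map (\<lambda>i. if K' i then concat (map (\<lambda>j. if K' j then [of_bool (a' i j)] else []) [0..<n])
      else []) [0..<n] :: nat list list)"
    by (intro map_cong) (simp_all only: set_upt atLeastLessThan_iff)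
  ultimately show ?thesis unfolding subgraph_word_def by (simp only:)
qed

lemma kernel_prog_computes:
  "\<exists>p. \<forall>(G :: 'a pair_pre_digraph) X vs. enumerates vs G \<longrightarrow>
    (\<exists>vs'. enumerates vs' (induced G (kept vs G X)) \<and>
      ram_computes_within (subgraph_prog (keep_fm 1 0) (keep_fm 2 1)) (encode vs G X)
        (poly p (length (encode vs G X))) (encode vs' (induced G (kept vs G X)) (kept vs G X)))"
proof -
  have "wf_fm (keep_fm 1 0) 1" "wf_fm (keep_fm 2 1) 2"
    by (simp_all add: wf_keep_fm)
  from runs_subgraph_prog[OF this] obtain p where p: "\<forall>s K. reg s = (\<lambda>_. 0) \<longrightarrow> out s = [] \<longrightarrow>
    (\<forall>e. sem (mem s) (mem s 0) (keep_fm 1 0) 1 e \<longleftrightarrow> K (e 0)) \<longrightarrow>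
    (\<forall>e. sem (mem s) (mem s 0) (keep_fm 2 1) 2 e \<longleftrightarrow> K (e 1)) \<longrightarrow>
    runs (subgraph_prog (keep_fm 1 0) (keep_fm 2 1)) s (poly p (mem s 0)) (\<lambda>s'. out s' =
      subgraph_word (mem s 0) K (\<lambda>i j. mem s (1 + mem s 0 + i * mem s 0 + j) \<noteq> 0))"
    by (rule exE)
  have "\<exists>vs'. enumerates vs' (induced G (kept vs G X)) \<and>
      ram_computes_within (subgraph_prog (keep_fm 1 0) (keep_fm 2 1)) (encode vs G X)
        (poly p (length (encode vs G X))) (encode vs' (induced G (kept vs G X)) (kept vs G X))"
    if vs: "enumerates vs G" for G :: "'a pair_pre_digraph" and X vs
  proof -
    define s where "s = input_state (encode vs G X)"
    define n where "n = length vs"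
    define m where "m = mem s"
    define K where "K = keep n (\<lambda>i j. m (1 + n + i * n + j) \<noteq> 0) (\<lambda>i. m (1 + i) \<noteq> 0)"
    define k where "k = keep n (\<lambda>i j. (vs ! i, vs ! j) \<in> parcs G) (\<lambda>i. vs ! i \<in> X)"
    have m: "m 0 = n" "\<And>i. i < n \<Longrightarrow> m (1 + i) \<noteq> 0 \<longleftrightarrow> vs ! i \<in> X"
      "\<And>i j. i < n \<Longrightarrow> j < n \<Longrightarrow> m (1 + n + i * n + j) \<noteq> 0 \<longleftrightarrow> (vs ! i, vs ! j) \<in> parcs G"
      unfolding m_def s_def using mem_encode[OF n_def, where G = G and X = X] by simp_all
    have Kk: "K i \<longleftrightarrow> k i" if "i < n" for i
      unfolding K_def k_def using m that by (intro keep_cong)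
    have "\<forall>e. sem m n (keep_fm 1 0) 1 e \<longleftrightarrow> K (e 0)" "\<forall>e. sem m n (keep_fm 2 1) 2 e \<longleftrightarrow> K (e 1)"
      unfolding K_def by (rule allI, rule sem_keep_fm, simp)+
    moreover have "reg s = (\<lambda>_. 0)" "out s = []" by (simp_all add: s_def input_state_def)
    ultimately have "runs (subgraph_prog (keep_fm 1 0) (keep_fm 2 1)) s (poly p n)
        (\<lambda>s'. out s' = subgraph_word n K (\<lambda>i j. m (1 + n + i * n + j) \<noteq> 0))"
      using p m(1) unfolding m_def by blast
    moreover have "subgraph_word n K (\<lambda>i j. m (1 + n + i * n + j) \<noteq> 0) =
        subgraph_word n k (\<lambda>i j. (vs ! i, vs ! j) \<in> parcs G)"
      using Kk m(3) by (intro subgraph_word_cong)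
    ultimately have run: "runs (subgraph_prog (keep_fm 1 0) (keep_fm 2 1)) s (poly p n)
        (\<lambda>s'. out s' = subgraph_word n k (\<lambda>i j. (vs ! i, vs ! j) \<in> parcs G))"
      by simp
    \<comment> \<open>The time was bounded in the number of vertices; polynomials over the naturals
      are monotone, so the input length may replace it.\<close>
    have "n \<le> length (encode vs G X)" by (simp add: encode_def n_def)
    then have "poly p n \<le> poly p (length (encode vs G X))" by (rule poly_nat_mono)
    with run have "ram_computes_within (subgraph_prog (keep_fm 1 0) (keep_fm 2 1)) (encode vs G X)
        (poly p (length (encode vs G X))) (subgraph_word n k (\<lambda>i j. (vs ! i, vs ! j) \<in> parcs G))"
      unfolding ram_computes_within_def runs_def s_def by (meson order_trans)
    with encode_induced_kept[OF vs, of X, folded n_def, folded k_def] show ?thesis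
      by metis
  qed
  then show ?thesis by blast
qed

text \<open>Program, polynomial and constants precede the instance. \<open>k\<^sub>0\<close> admits
  a constant-size output, as the cubic bound vanishes for empty \<open>X\<close>.\<close>

theorem theorem6:
  shows "\<exists>(c :: com) (p :: nat poly) (k :: nat) (k\<^sub>0 :: nat).
    \<forall>(G :: nat pair_pre_digraph) X vs.
      mod_co_cluster_instance G X \<and> enumerates vs G \<longrightarrow>
      (\<exists>(G' :: nat pair_pre_digraph) X' vs'.
         mod_co_cluster_instance G' X' \<and> enumerates vs' G' \<and>
         ram_computes_within c (encode vs G X)
           (poly p (length (encode vs G X))) (encode vs' G' X') \<and>
         (has_stable_cutset G' \<longleftrightarrow> has_stable_cutset G) \<and>
         (card (pverts G') \<le> k * card X ^ 3 \<or> card (pverts G') \<le> k\<^sub>0))"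
proof -
  let ?c = "subgraph_prog (keep_fm 1 0) (keep_fm 2 1)"
  obtain p where p: "\<And>(G :: nat pair_pre_digraph) X vs. enumerates vs G \<Longrightarrow>
    \<exists>vs'. enumerates vs' (induced G (kept vs G X)) \<and> ram_computes_within ?c (encode vs G X)
      (poly p (length (encode vs G X))) (encode vs' (induced G (kept vs G X)) (kept vs G X))"
    using kernel_prog_computes by meson
  show ?thesis
  \<comment> \<open>For nonempty \<open>X\<close>, 13 = 1 + 9 + 3 since both \<open>card X\<close>
    and 1 are at most \<open>card X ^ 3\<close>. For empty \<open>X\<close> only the 9
    remains.\<close>
  proof (rule exI[of _ ?c], rule exI[of _ p], rule exI[of _ 13], rule exI[of _ 9], intro allI impI)
    fix G :: "nat pair_pre_digraph" and X vs
    assume *: "mod_co_cluster_instance G X \<and> enumerates vs G"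
    then have inst: "mod_co_cluster_instance G X" and vs: "enumerates vs G" by auto
    let ?K = "kept vs G X"
    let ?G' = "induced G ?K"
    obtain vs' where vs': "enumerates vs' ?G'" "ram_computes_within ?c (encode vs G X)
        (poly p (length (encode vs G X))) (encode vs' ?G' ?K)"
      using p[OF vs] by blast
    interpret co_cluster_kernel "pverts G" "parcs G" X ?K
      by (rule co_cluster_kernel_kept) fact+
    have G: "pair_graph G" "X \<subseteq> pverts G" using inst by (simp_all add: mod_co_cluster_instance_def)
    have pv: "pverts ?G' = ?K" by (simp add: induced_def)
    have "mod_co_cluster_instance ?G' ?K"
      using pair_graph_induced[OF G(1) KV] co_cluster_del_all_verts[of ?G'] pv
      by (simp add: mod_co_cluster_instance_def)
    moreover have "card (pverts ?G') \<le> 13 * card X ^ 3 \<or> card (pverts ?G') \<le> 9"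
    proof -
      have "card ?K \<le> card X + 9 + 3 * card X ^ 3"
        using vs G(2) by (intro card_kept_le) (auto simp: enumerates_def)
      moreover have "card X \<le> card X ^ 3" by (cases "card X") (simp_all add: power3_eq_cube)
      moreover have "1 \<le> card X ^ 3" if "card X \<noteq> 0" using that by (simp add: Suc_leI)
      ultimately show ?thesis unfolding pv by (cases "card X = 0") auto
    qed
    ultimately show "\<exists>(G' :: nat pair_pre_digraph) X' vs'.
         mod_co_cluster_instance G' X' \<and> enumerates vs' G' \<and>
         ram_computes_within ?c (encode vs G X)
           (poly p (length (encode vs G X))) (encode vs' G' X') \<and>
         (has_stable_cutset G' \<longleftrightarrow> has_stable_cutset G) \<and>
         (card (pverts G') \<le> 13 * card X ^ 3 \<or> card (pverts G') \<le> 9)"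
      using vs' has_stable_cutset_induced_kept[OF inst vs] by blast
  qed
qed

end
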